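(* There exist a finitely presented automatic monoid $S$ and an automatic structure for $S$, with language of representatives $L$ and interpretation $\sigma$, such that there is no algorithm which, given a word $w\in L$, decides whether $\sigma(w)$ has a right inverse in $S$.
   Context: Let $A$ be a finite alphabet, $\$ \notin A$, and let $\delta$ send a pair of words over $A$ to the word over $(A\cup\{\$\})\times(A\cup\{\$\})$ obtained by padding the shorter word on the right with $\$$ and reading both letter by letter. A synchronous automaton recognises a relation $R$ if it accepts exactly $\delta(R)$. An automatic structure for a semigroup $S$ consists of a finite alphabet $A$, a finite automaton recognising $L\subseteq A^*$, a synchronous automaton recognising $L_=\subseteq L\times L$, and for each $a\in A$ a synchronous automaton recognising $L_a\subseteq L\times L$, together with the existence of a morphism $\sigma:A^*\to S$ (an interpretation) with $\sigma(L)=S$ such that for $u,v\in L$: $(u,v)\in L_=$ iff $\sigma(u)=\sigma(v)$, and $(u,v)\in L_a$ iff $\sigma(ua)=\sigma(v)$. A semigroup is automatic if it has an automatic structure. In a monoid with identity $1$, a right inverse of $s$ is an element $t$ with $st=1$. *)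

theory Defs
  imports "HOL-Algebra.Group" "HOL-Library.Nat_Bijection"
begin

definition recognisable :: "'b set \<Rightarrow> 'b list set \<Rightarrow> bool" where
  "recognisable Alph L \<longleftrightarrow> L \<subseteq> lists Alph \<and>
     (\<exists>(Q::nat set) q0 (delta :: nat \<Rightarrow> 'b \<Rightarrow> nat) F.
        finite Q \<and> q0 \<in> Q \<and> (\<forall>q\<in>Q. \<forall>a\<in>Alph. delta q a \<in> Q) \<and> F \<subseteq> Q \<and>
        L = {w \<in> lists Alph. foldl delta q0 w \<in> F})"

definition pad_conv :: "'a list \<Rightarrow> 'a list \<Rightarrow> ('a option \<times> 'a option) list" where
  "pad_conv u v =
     zip (map Some u @ replicate (length v - length u) None)
         (map Some v @ replicate (length u - length v) None)"

definition pad_alph :: "'a set \<Rightarrow> ('a option \<times> 'a option) set" where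
  "pad_alph A = (insert None (Some ` A)) \<times> (insert None (Some ` A))"

definition sync_recognisable :: "'a set \<Rightarrow> ('a list \<times> 'a list) set \<Rightarrow> bool" where
  "sync_recognisable A R \<longleftrightarrow> recognisable (pad_alph A) ((\<lambda>(u, v). pad_conv u v) ` R)"

definition word_morphism :: "('c, 'm) monoid_scheme \<Rightarrow> 'a set \<Rightarrow> ('a list \<Rightarrow> 'c) \<Rightarrow> bool" where
  "word_morphism S A sigma \<longleftrightarrow>
     (\<forall>w\<in>lists A. sigma w \<in> carrier S) \<and> sigma [] = \<one>\<^bsub>S\<^esub> \<and>
     (\<forall>u\<in>lists A. \<forall>v\<in>lists A. sigma (u @ v) = sigma u \<otimes>\<^bsub>S\<^esub> sigma v)"

definition automatic_structure ::
  "('c, 'm) monoid_scheme \<Rightarrow> 'a set \<Rightarrow> 'a list set \<Rightarrow> ('a list \<times> 'a list) set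
     \<Rightarrow> ('a \<Rightarrow> ('a list \<times> 'a list) set) \<Rightarrow> ('a list \<Rightarrow> 'c) \<Rightarrow> bool" where
  "automatic_structure S A L Leq La sigma \<longleftrightarrow>
     finite A \<and> recognisable A L \<and>
     Leq \<subseteq> L \<times> L \<and> sync_recognisable A Leq \<and>
     (\<forall>a\<in>A. La a \<subseteq> L \<times> L \<and> sync_recognisable A (La a)) \<and>
     word_morphism S A sigma \<and> sigma ` L = carrier S \<and>
     (\<forall>u\<in>L. \<forall>v\<in>L. (u, v) \<in> Leq \<longleftrightarrow> sigma u = sigma v) \<and>
     (\<forall>a\<in>A. \<forall>u\<in>L. \<forall>v\<in>L. (u, v) \<in> La a \<longleftrightarrow> sigma (u @ [a]) = sigma v)"

inductive_set congr_gen :: "('a list \<times> 'a list) set \<Rightarrow> ('a list \<times> 'a list) set"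
  for R where
  base: "(u, v) \<in> R \<Longrightarrow> (u, v) \<in> congr_gen R"
| refl: "(u, u) \<in> congr_gen R"
| sym: "(u, v) \<in> congr_gen R \<Longrightarrow> (v, u) \<in> congr_gen R"
| trans: "(u, v) \<in> congr_gen R \<Longrightarrow> (v, w) \<in> congr_gen R \<Longrightarrow> (u, w) \<in> congr_gen R"
| ctxt: "(u, v) \<in> congr_gen R \<Longrightarrow> (p @ u @ q, p @ v @ q) \<in> congr_gen R"

definition finitely_presented :: "('c, 'm) monoid_scheme \<Rightarrow> bool" where
  "finitely_presented S \<longleftrightarrow>
     (\<exists>(X::nat set) R phi. finite X \<and> finite R \<and> R \<subseteq> lists X \<times> lists X \<and>
        word_morphism S X phi \<and> phi ` lists X = carrier S \<and>
        (\<forall>u\<in>lists X. \<forall>v\<in>lists X. phi u = phi v \<longleftrightarrow> (u, v) \<in> congr_gen R))"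

definition has_right_inverse :: "('c, 'm) monoid_scheme \<Rightarrow> 'c \<Rightarrow> bool" where
  "has_right_inverse S s \<longleftrightarrow> (\<exists>t\<in>carrier S. s \<otimes>\<^bsub>S\<^esub> t = \<one>\<^bsub>S\<^esub>)"

datatype recf = Zero | Succ | Proj nat | Comp recf "recf list" | PrimRec recf recf | Mini recf

inductive reval :: "recf \<Rightarrow> nat list \<Rightarrow> nat \<Rightarrow> bool" where
  zero: "reval Zero xs 0"
| succ: "reval Succ (x # xs) (Suc x)"
| proj: "i < length xs \<Longrightarrow> reval (Proj i) xs (xs ! i)"
| comp: "list_all2 (\<lambda>g y. reval g xs y) gs ys \<Longrightarrow> reval f ys z \<Longrightarrow> reval (Comp f gs) xs z"
| pr0: "reval f xs z \<Longrightarrow> reval (PrimRec f g) (0 # xs) z"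
| prS: "reval (PrimRec f g) (n # xs) y \<Longrightarrow> reval g (n # y # xs) z
          \<Longrightarrow> reval (PrimRec f g) (Suc n # xs) z"
| mini: "reval f (n # xs) 0 \<Longrightarrow> (\<forall>m<n. \<exists>y. reval f (m # xs) (Suc y))
          \<Longrightarrow> reval (Mini f) xs n"

definition decidable_on :: "nat list set \<Rightarrow> (nat list \<Rightarrow> bool) \<Rightarrow> bool" where
  "decidable_on L P \<longleftrightarrow>
     (\<exists>f. \<forall>w\<in>L. reval f [list_encode w] (if P w then 1 else 0))"

end

theory Submission
  imports Defs "HOL-Library.Countable"
begin

text \<open>
  Simulate a counter machine in a monoid: a configuration with control state \<open>P\<close> and counters \<open>s\<close> is a word
  \<open>St P x End\<close>, where \<open>x\<close> contains each letter \<open>Ctr j\<close> exactly \<open>s j\<close> times, in any order and mixed with blanks.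
  Right multiplication by a letter \<open>Start p\<close> sends a token to the left through \<open>End\<close> and \<open>x\<close>, which performs the
  operation \<open>p\<close> when it arrives at \<open>St P\<close> and otherwise gets stuck for ever. The rules of this rewriting
  system have left-hand sides of two letters that never overlap, and one multiplication changes a normal form
  by a letterwise rewriting shifted by at most one position, so the monoid is finitely presented and automatic.
  From a halting state the whole configuration can be turned into letters that are erased one by one;
  a configuration therefore has a right inverse iff the machine halts from it.

  On input \<open>c\<close> the machine runs the recursive function with code \<open>c\<close> on \<open>c\<close> and halts iff the result is \<open>0\<close>. A decider \<open>f\<close> for
  right invertibility composed with the (recursive) code of the input word is a total recursive function; on its own
  code \<open>c\<close> it returns \<open>0\<close> iff the word for \<open>c\<close> has a right inverse, a contradiction. Since this function is total, only the
  implication ``if the function returns \<open>y\<close>, then so does its simulation'' is needed of the universal function and the compiler.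
\<close>

section \<open>Recognisable languages\<close>

text \<open>\<open>recognisable\<close> asks for states in \<open>nat\<close>. An injection of the
  finite set \<open>Q\<close> into \<open>nat\<close> renames the states, so the automata below may
  use any state type; the accepting states are cut down to \<open>Q\<close>.\<close>

lemma recognisable_dfa:
  fixes Q :: "'q set"
  assumes "finite Q" "q0 \<in> Q" "\<And>q a. q \<in> Q \<Longrightarrow> a \<in> Alph \<Longrightarrow> delta q a \<in> Q"
    and L: "L = {w \<in> lists Alph. foldl delta q0 w \<in> F}"
  shows "recognisable Alph L"
proof -
  obtain f :: "'q \<Rightarrow> nat" where inj: "inj_on f Q"
    using finite_imp_inj_to_nat_seg[OF assms(1)] by blast
  define g where "g = inv_into Q f"
  have gf: "g (f q) = q" if "q \<in> Q" for q
    using that inj by (simp add: g_def)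
  define d where "d n a = f (delta (g n) a)" for n a
  have run: "foldl d (f q) w = f (foldl delta q w) \<and> foldl delta q w \<in> Q"
    if "w \<in> lists Alph" "q \<in> Q" for w q
    using that by (induction w arbitrary: q) (auto simp: d_def gf assms(3))
  have acc: "f q \<in> f ` (F \<inter> Q) \<longleftrightarrow> q \<in> F" if "q \<in> Q" for q
    using that inj by (auto simp: inj_on_def)
  have L': "L = {w \<in> lists Alph. foldl d (f q0) w \<in> f ` (F \<inter> Q)}"
    unfolding L using run[OF _ assms(2)] acc by (metis (no_types, lifting))
  show ?thesis
    unfolding recognisable_def
  proof (intro conjI exI)
    show "L \<subseteq> lists Alph" unfolding L by blast
    show "finite (f ` Q)" "f q0 \<in> f ` Q" using assms by auto
    show "\<forall>q\<in>f ` Q. \<forall>a\<in>Alph. d q a \<in> f ` Q"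
      using assms(3) by (simp add: d_def gf)
    show "f ` (F \<inter> Q) \<subseteq> f ` Q" by blast
  qed (rule L')
qed

lemma recognisable_Int:
  assumes "recognisable Alph L" "recognisable Alph M"
  shows "recognisable Alph (L \<inter> M)"
proof -
  obtain Q q0 F and d :: "nat \<Rightarrow> 'a \<Rightarrow> nat" where 1: "finite Q" "q0 \<in> Q" "\<forall>q\<in>Q. \<forall>a\<in>Alph. d q a \<in> Q"
     "L = {w \<in> lists Alph. foldl d q0 w \<in> F}"
    using assms(1) unfolding recognisable_def by blast
  obtain P p0 G and e :: "nat \<Rightarrow> 'a \<Rightarrow> nat" where 2: "finite P" "p0 \<in> P" "\<forall>q\<in>P. \<forall>a\<in>Alph. e q a \<in> P"
     "M = {w \<in> lists Alph. foldl e p0 w \<in> G}"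
    using assms(2) unfolding recognisable_def by blast
  have "foldl (\<lambda>(q, p) a. (d q a, e p a)) (q, p) w = (foldl d q w, foldl e p w)" for q p w
    by (induction w arbitrary: q p) auto
  then show ?thesis
    using 1 2
    by (intro recognisable_dfa[where Q = "Q \<times> P" and ?q0.0 = "(q0, p0)" and F = "F \<times> G"
          and delta = "\<lambda>(q, p) a. (d q a, e p a)"]) auto
qed

fun npath :: "('q \<Rightarrow> 'b \<Rightarrow> 'q set) \<Rightarrow> 'q \<Rightarrow> 'b list \<Rightarrow> 'q \<Rightarrow> bool" where
  "npath d q [] r \<longleftrightarrow> q = r"
| "npath d q (b # w) r \<longleftrightarrow> (\<exists>p\<in>d q b. npath d p w r)"

text \<open>Subset construction: the deterministic state after \<open>w\<close> is the set of all
  states reachable from \<open>I\<close> along \<open>w\<close>.\<close>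

lemma recognisable_nfa:
  assumes "finite Q" "I \<subseteq> Q" "\<And>q a. q \<in> Q \<Longrightarrow> a \<in> Alph \<Longrightarrow> d q a \<subseteq> Q"
    and L: "L = {w \<in> lists Alph. \<exists>q\<in>I. \<exists>r\<in>F. npath d q w r}"
  shows "recognisable Alph L"
proof -
  have run: "foldl (\<lambda>S b. \<Union>q\<in>S. d q b) S w = {r. \<exists>q\<in>S. npath d q w r}" for S w
    by (induction w arbitrary: S) auto
  show ?thesis
  proof (rule recognisable_dfa)
    show "finite (Pow Q)" "I \<in> Pow Q" using assms by auto
    show "(\<Union>q\<in>S. d q b) \<in> Pow Q" if "S \<in> Pow Q" "b \<in> Alph" for S b
      using assms(3) that by blast
    show "L = {w \<in> lists Alph. foldl (\<lambda>S b. \<Union>q\<in>S. d q b) I w \<in> {S. S \<inter> F \<noteq> {}}}"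
      unfolding L run by auto
  qed
qed

section \<open>Convolutions of pairs of words\<close>

lemma pad_conv_simps [simp]:
  "pad_conv [] [] = []"
  "pad_conv (x # u) (y # v) = (Some x, Some y) # pad_conv u v"
  "pad_conv [] (y # v) = (None, Some y) # pad_conv [] v"
  "pad_conv (x # u) [] = (Some x, None) # pad_conv u []"
  by (auto simp: pad_conv_def)

text \<open>Dropping the padding \<open>None\<close> recovers the first word, so a condition on that
  word can be tested on the convolution.\<close>

lemma map_filter_fst_pad_conv: "List.map_filter fst (pad_conv u v) = u"
proof (induction u arbitrary: v)
  case Nil
  then show ?case by (induction v) (simp_all add: List.map_filter_simps)
next
  case (Cons x u)
  then show ?case by (cases v) (simp_all add: List.map_filter_simps)
qed

lemma pad_conv_in_lists:
  "u \<in> lists A \<Longrightarrow> v \<in> lists A \<Longrightarrow> pad_conv u v \<in> lists (pad_alph A)"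
proof (induction u arbitrary: v)
  case Nil
  then show ?case by (induction v) (auto simp: pad_alph_def)
next
  case (Cons x u)
  then show ?case by (cases v) (auto simp: pad_alph_def)
qed

section \<open>Monoids of sliding tokens\<close>

text \<open>What happens when a token \<open>y\<close> meets the letter \<open>x\<close> on its
  left. \<open>Move t m\<close> and \<open>Put a b\<close> rewrite the two letters in the same way
  but differ in the role of the first new letter: \<open>t\<close> travels on to the left as a
  token, \<open>a\<close> comes to rest.\<close>

datatype 'a outcome = Stuck | Move 'a 'a | Put 'a 'a | Del

fun rhs :: "'a outcome \<Rightarrow> 'a list" where
  "rhs Stuck = []"
| "rhs (Move t m) = [t, m]"
| "rhs (Put a b) = [a, b]"
| "rhs Del = []"

text \<open>The word that is multiplied by a letter on the right is stored reversed.\<close>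

fun rmul :: "('a \<Rightarrow> 'a \<Rightarrow> 'a outcome) \<Rightarrow> 'a list \<Rightarrow> 'a \<Rightarrow> 'a list" where
  "rmul out [] y = [y]"
| "rmul out (x # z) y =
     (case out x y of
        Stuck \<Rightarrow> y # x # z
      | Move t m \<Rightarrow> m # rmul out z t
      | Put a b \<Rightarrow> b # a # z
      | Del \<Rightarrow> z)"

abbreviation inert :: "('a \<Rightarrow> 'a \<Rightarrow> 'a outcome) \<Rightarrow> 'a \<Rightarrow> bool" where
  "inert out p \<equiv> (\<forall>x. out x p = Stuck)"

lemma rmul_inert: "inert out p \<Longrightarrow> rmul out z p = p # z"
  by (cases z) auto

lemma foldl_rmul_inert: "\<forall>p\<in>set w. inert out p \<Longrightarrow> foldl (rmul out) z w = rev w @ z"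
  by (induction w arbitrary: z) (auto simp: rmul_inert)

text \<open>The argument is a reversed word: \<open>y # x # z\<close> ends in the factor with
  \<open>x\<close> before \<open>y\<close>. No such factor may be a left-hand side of a
  rule.\<close>

fun irr :: "('a \<Rightarrow> 'a \<Rightarrow> 'a outcome) \<Rightarrow> 'a list \<Rightarrow> bool" where
  "irr out [] \<longleftrightarrow> True"
| "irr out [x] \<longleftrightarrow> True"
| "irr out (y # x # z) \<longleftrightarrow> out x y = Stuck \<and> irr out (x # z)"

lemma irr_inert: "inert out p \<Longrightarrow> irr out (p # z) \<longleftrightarrow> irr out z"
  by (cases z) auto

lemma irr_tl: "irr out (x # z) \<Longrightarrow> irr out z"
  by (cases z) auto

datatype 'a phase = Diag | Carry 'a 'a | Done

text \<open>By \<open>inert_left\<close> the first letter of a redex is never the second letter of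
  one, so left-hand sides do not overlap. \<open>inert_Move\<close> and \<open>inert_Put\<close>
  prevent the new letters from forming redexes with their left neighbours. By
  \<open>Del_Move\<close> a token that has moved is never deleted, so deletion happens only at the
  right end of a word, where an automaton reading padded pairs can follow it.\<close>

locale sliding =
  fixes A :: "'a set" and out :: "'a \<Rightarrow> 'a \<Rightarrow> 'a outcome"
  assumes fin: "finite A"
    and closed: "x \<in> A \<Longrightarrow> y \<in> A \<Longrightarrow> set (rhs (out x y)) \<subseteq> A"
    and inert_left: "out x y \<noteq> Stuck \<Longrightarrow> inert out x"
    and inert_Move: "out x y = Move t m \<Longrightarrow> inert out m"
    and inert_Put: "out x y = Put a b \<Longrightarrow> inert out a \<and> inert out b"
    and Del_Move: "out x s = Del \<Longrightarrow> out z t \<noteq> Move s m"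
begin

definition rules :: "('a list \<times> 'a list) set" where
  "rules = {([x, y], rhs (out x y)) |x y. x \<in> A \<and> y \<in> A \<and> out x y \<noteq> Stuck}"

lemma rules_finite: "finite rules"
proof -
  have "rules \<subseteq> (\<lambda>(x, y). ([x, y], rhs (out x y))) ` (A \<times> A)"
    unfolding rules_def by auto
  then show ?thesis using fin by (meson finite_SigmaI finite_imageI finite_subset)
qed

lemma rules_lists: "rules \<subseteq> lists A \<times> lists A"
  using closed by (auto simp: rules_def)

text \<open>The letter \<open>x\<close> is inert, so it is merely appended before \<open>y\<close>
  meets it. On the other side a moving token \<open>t\<close> runs through \<open>z\<close> first,
  and then the inert \<open>m\<close> is appended behind it.\<close>

lemma rmul_redex:
  assumes "out x y \<noteq> Stuck"
  shows "foldl (rmul out) z [x, y] = foldl (rmul out) z (rhs (out x y))"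
  using assms inert_left[OF assms] inert_Move[of x y] inert_Put[of x y]
  by (cases "out x y") (auto simp: rmul_inert)

text \<open>\<open>rmul\<close> makes words act on words from the right, and both sides of a rule
  act alike, hence so do congruent words. Acting on the empty word then gives unique normal forms
  without a confluence argument.\<close>

lemma congr_rmul_eq: "(u, v) \<in> congr_gen rules \<Longrightarrow> foldl (rmul out) z u = foldl (rmul out) z v"
proof (induction arbitrary: z rule: congr_gen.induct)
  case (base u v)
  then show ?case using rmul_redex unfolding rules_def by blast
qed auto

lemma rmul_lists: "z \<in> lists A \<Longrightarrow> y \<in> A \<Longrightarrow> rmul out z y \<in> lists A"
proof (induction z arbitrary: y)
  case (Cons x z)
  then show ?case using closed[of x y] by (cases "out x y") auto
qed auto

lemma foldl_rmul_lists: "z \<in> lists A \<Longrightarrow> w \<in> lists A \<Longrightarrow> foldl (rmul out) z w \<in> lists A"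
  by (induction w arbitrary: z) (auto simp: rmul_lists)

lemma congr_rmul: "z \<in> lists A \<Longrightarrow> y \<in> A \<Longrightarrow> (rev z @ [y], rev (rmul out z y)) \<in> congr_gen rules"
proof (induction z arbitrary: y)
  case Nil
  then show ?case by (simp add: congr_gen.refl)
next
  case (Cons x z)
  have red: "(rev z @ [x, y], rev z @ rhs (out x y)) \<in> congr_gen rules" if "out x y \<noteq> Stuck"
  proof -
    have "([x, y], rhs (out x y)) \<in> congr_gen rules"
      using Cons.prems that by (intro congr_gen.base) (auto simp: rules_def)
    from congr_gen.ctxt[OF this, of "rev z" "[]"] show ?thesis by simp
  qed
  show ?case
  proof (cases "out x y")
    case Stuck
    then show ?thesis by (simp add: congr_gen.refl)
  next
    case (Move t m)
    then have "t \<in> A" using closed[of x y] Cons.prems by auto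
    then have "(rev z @ [t], rev (rmul out z t)) \<in> congr_gen rules" using Cons by auto
    from congr_gen.ctxt[OF this, of "[]" "[m]"]
    show ?thesis using red Move by (auto intro: congr_gen.trans)
  qed (use red in auto)
qed

definition nf :: "'a list \<Rightarrow> 'a list" where
  "nf w = rev (foldl (rmul out) [] w)"

lemma nf_Nil [simp]: "nf [] = []"
  by (simp add: nf_def)

lemma nf_snoc: "nf (w @ [y]) = rev (rmul out (rev (nf w)) y)"
  by (simp add: nf_def)

lemma nf_lists: "w \<in> lists A \<Longrightarrow> nf w \<in> lists A"
  using foldl_rmul_lists[of "[]" w] by (auto simp: nf_def)

lemma congr_nf: "w \<in> lists A \<Longrightarrow> (w, nf w) \<in> congr_gen rules"
proof (induction w rule: rev_induct)
  case Nil
  then show ?case by (simp add: congr_gen.refl)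
next
  case (snoc y w)
  have "(w @ [y], nf w @ [y]) \<in> congr_gen rules"
    using congr_gen.ctxt[of w "nf w" rules "[]" "[y]"] snoc by simp
  moreover have "(rev (rev (nf w)) @ [y], nf (w @ [y])) \<in> congr_gen rules"
    unfolding nf_snoc using snoc.prems nf_lists[of w] by (intro congr_rmul) auto
  ultimately show ?case by (auto intro: congr_gen.trans)
qed

lemma nf_eq_iff:
  assumes "u \<in> lists A" "v \<in> lists A"
  shows "nf u = nf v \<longleftrightarrow> (u, v) \<in> congr_gen rules"
proof
  assume "nf u = nf v"
  then show "(u, v) \<in> congr_gen rules"
    using congr_nf[OF assms(1)] congr_nf[OF assms(2)]
    by (metis congr_gen.trans congr_gen.sym)
qed (simp add: nf_def congr_rmul_eq)

lemma nf_append: "u \<in> lists A \<Longrightarrow> v \<in> lists A \<Longrightarrow> nf (nf u @ nf v) = nf (u @ v)"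
proof -
  assume uv: "u \<in> lists A" "v \<in> lists A"
  have "foldl (rmul out) z (nf u @ nf v) = foldl (rmul out) z (u @ v)" for z
    using congr_rmul_eq[OF congr_nf[OF uv(1)]] congr_rmul_eq[OF congr_nf[OF uv(2)]] by simp
  then show ?thesis by (simp add: nf_def)
qed

lemma irr_rmul: "irr out z \<Longrightarrow> irr out (rmul out z y)"
proof (induction z arbitrary: y)
  case (Cons x z)
  show ?case
  proof (cases "out x y")
    case (Move t m)
    then show ?thesis using Cons inert_Move[OF Move] by (simp add: irr_inert irr_tl)
  next
    case (Put a b)
    then show ?thesis using Cons.prems inert_Put[OF Put] by (simp add: irr_inert irr_tl)
  qed (use Cons.prems in \<open>auto intro: irr_tl\<close>)
qed simp

lemma irr_nf: "irr out (rev (nf w))"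
proof (induction w rule: rev_induct)
  case (snoc y w)
  then show ?case using irr_rmul by (simp add: nf_snoc)
qed simp

lemma nf_irr: "irr out (rev w) \<Longrightarrow> nf w = w"
proof (induction w rule: rev_induct)
  case (snoc y w)
  then have "nf w = w" by (simp add: irr_tl)
  moreover have "rmul out (rev w) y = y # rev w"
    using snoc.prems by (cases "rev w") auto
  ultimately show ?case by (simp add: nf_snoc)
qed simp

section \<open>Normal forms as a regular language of representatives\<close>

definition reps :: "'a list set" where
  "reps = {w \<in> lists A. irr out (rev w)}"

lemma nf_in_reps: "w \<in> lists A \<Longrightarrow> nf w \<in> reps"
  using nf_lists[of w] by (simp add: reps_def irr_nf)

lemma nf_reps: "w \<in> reps \<Longrightarrow> nf w = w"
  by (simp add: reps_def nf_irr)

lemma reps_lists: "w \<in> reps \<Longrightarrow> w \<in> lists A"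
  by (simp add: reps_def)

text \<open>Irreducibility concerns adjacent letters only, so the automaton remembers the last
  letter read, with \<open>None\<close> before the first.\<close>

lemma recognisable_reps: "recognisable A reps"
proof -
  define d :: "'a option \<Rightarrow> 'a \<Rightarrow> 'a option set" where
    "d = (\<lambda>q y. case q of None \<Rightarrow> {Some y} | Some x \<Rightarrow> if out x y = Stuck then {Some y} else {})"
  define F where "F = insert None (Some ` A)"
  have irr_Cons: "irr out (rev w @ [x]) \<longleftrightarrow> (\<exists>r\<in>F. npath d (Some x) w r)" if "x \<in> A" "w \<in> lists A" for w x
    using that
  proof (induction w arbitrary: x)
    case Nil
    then show ?case by (simp add: F_def)
  next
    case (Cons y w)
    have "irr out (z @ [y, x]) \<longleftrightarrow> irr out (z @ [y]) \<and> out x y = Stuck" for z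
    proof (induction z)
      case (Cons b z)
      then show ?case by (cases z) auto
    qed auto
    then show ?case using Cons by (auto simp: d_def)
  qed
  have "irr out (rev w) \<longleftrightarrow> (\<exists>r\<in>F. npath d None w r)" if "w \<in> lists A" for w
    using that irr_Cons by (cases w) (auto simp: d_def F_def)
  then have *: "reps = {w \<in> lists A. \<exists>q\<in>{None}. \<exists>r\<in>F. npath d q w r}"
    unfolding reps_def by blast
  show ?thesis
    by (rule recognisable_nfa[OF _ _ _ *, where Q = F])
      (auto simp: F_def fin d_def split: option.splits)
qed

lemma recognisable_fst_reps:
  "recognisable (pad_alph A) {p \<in> lists (pad_alph A). List.map_filter fst p \<in> reps}"
proof -
  obtain Q q0 F and d :: "nat \<Rightarrow> 'a \<Rightarrow> nat" where 1: "finite Q" "q0 \<in> Q" "\<forall>q\<in>Q. \<forall>a\<in>A. d q a \<in> Q"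
     "reps = {w \<in> lists A. foldl d q0 w \<in> F}"
    using recognisable_reps unfolding recognisable_def by blast
  define e where "e q b = (case fst b of None \<Rightarrow> q | Some x \<Rightarrow> d q x)" for q and b :: "'a option \<times> 'a option"
  have *: "foldl e q p = foldl d q (List.map_filter fst p)" for q p
    by (induction p arbitrary: q) (auto simp: e_def List.map_filter_simps split: option.splits)
  have **: "x \<in> A" if "x \<in> set (List.map_filter fst p)" "p \<in> lists (pad_alph A)" for x p
    using that by (induction p) (auto simp: pad_alph_def List.map_filter_simps split: option.splits)
  have reps_iff: "List.map_filter fst p \<in> reps \<longleftrightarrow> foldl e q0 p \<in> F" if "p \<in> lists (pad_alph A)" for p
  proof -
    have "List.map_filter fst p \<in> lists A" using that ** by blast
    then show ?thesis unfolding 1(4) * by simp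
  qed
  show ?thesis
    by (rule recognisable_dfa[where Q = Q and ?q0.0 = q0 and delta = e and F = F])
      (use 1(1-3) reps_iff in \<open>auto simp: e_def pad_alph_def split: option.splits\<close>)
qed

text \<open>\<open>K\<close> checks \<open>P\<close> on arbitrary words; membership of the first
  word in \<open>reps\<close> is imposed by intersection. \<open>K_conv\<close> rules out words over
  the padded alphabet that are not convolutions.\<close>

lemma sync_recognisable_if_nfa:
  assumes nfa: "recognisable (pad_alph A) K"
    and K: "\<And>u v. u \<in> lists A \<Longrightarrow> v \<in> lists A \<Longrightarrow> pad_conv u v \<in> K \<longleftrightarrow> P u v"
    and K_conv: "\<And>p. p \<in> K \<Longrightarrow> \<exists>u\<in>lists A. \<exists>v\<in>lists A. p = pad_conv u v"
    and R: "R = {(u, v). u \<in> reps \<and> v \<in> lists A \<and> P u v}"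
  shows "sync_recognisable A R"
proof -
  have "(\<lambda>(u, v). pad_conv u v) ` R = K \<inter> {p \<in> lists (pad_alph A). List.map_filter fst p \<in> reps}"
  proof (intro equalityI subsetI)
    fix p assume "p \<in> (\<lambda>(u, v). pad_conv u v) ` R"
    then obtain u v where "p = pad_conv u v" "u \<in> reps" "v \<in> lists A" "P u v"
      using R by auto
    then show "p \<in> K \<inter> {p \<in> lists (pad_alph A). List.map_filter fst p \<in> reps}"
      using K reps_lists pad_conv_in_lists[of u A v] by (auto simp: map_filter_fst_pad_conv)
  next
    fix p assume p: "p \<in> K \<inter> {p \<in> lists (pad_alph A). List.map_filter fst p \<in> reps}"
    then obtain u v where "u \<in> lists A" "v \<in> lists A" "p = pad_conv u v" using K_conv by blast
    moreover from this p have "u \<in> reps" "P u v" using K by (auto simp: map_filter_fst_pad_conv)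
    ultimately show "p \<in> (\<lambda>(u, v). pad_conv u v) ` R" using R by auto
  qed
  then show ?thesis
    unfolding sync_recognisable_def
    using recognisable_Int[OF nfa recognisable_fst_reps] by simp
qed

section \<open>Multiplication by a letter as a synchronous relation\<close>

text \<open>The token \<open>a\<close> runs by moves through the whole word, which is not reversed
  here. The result is the token leaving on the left and the trail it leaves, of the same length as
  the word; \<open>None\<close> means that it does not get through.\<close>

fun sweep :: "'a \<Rightarrow> 'a list \<Rightarrow> ('a \<times> 'a list) option" where
  "sweep a [] = Some (a, [])"
| "sweep a (y # x) =
     (case sweep a x of
        None \<Rightarrow> None
      | Some (t, ms) \<Rightarrow> (case out y t of Move s m \<Rightarrow> Some (s, m # ms) | _ \<Rightarrow> None))"

text \<open>Multiplication by a token that stops inside the word; \<open>step\<close> adds the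
  untouched prefix. Because of \<open>Del_Move\<close>, only a token that has not moved yet can be
  deleted, hence the one-letter word in \<open>del\<close>.\<close>

inductive stops :: "'a \<Rightarrow> 'a list \<Rightarrow> 'a list \<Rightarrow> bool" for a where
  stuck: "sweep a x = Some (s, ms) \<Longrightarrow> out c s = Stuck \<Longrightarrow> stops a (c # x) (c # s # ms)"
| put: "sweep a x = Some (s, ms) \<Longrightarrow> out c s = Put r1 r2 \<Longrightarrow> stops a (c # x) (r1 # r2 # ms)"
| del: "out c a = Del \<Longrightarrow> stops a [c] []"
| step: "stops a u v \<Longrightarrow> stops a (c # u) (c # v)"

lemma rmul_sweep: "sweep a x = Some (s, ms) \<Longrightarrow> rmul out (rev x @ z) a = rev ms @ rmul out z s"
  by (induction x arbitrary: s ms z) (auto split: option.splits outcome.splits)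

lemma rmul_stops: "stops a u v \<Longrightarrow> rmul out (rev u @ z) a = rev v @ z"
  by (induction arbitrary: z rule: stops.induct) (auto simp: rmul_sweep)

lemma stops_or_sweeps: "(\<exists>v. stops a u v) \<or> (\<exists>s ms. sweep a u = Some (s, ms))"
proof (induction u)
  case (Cons c u)
  show ?case
  proof (cases "\<exists>v. stops a u v")
    case True
    then show ?thesis using stops.step by blast
  next
    case False
    then obtain s ms where sw: "sweep a u = Some (s, ms)" using Cons by blast
    \<comment> \<open>If \<open>u\<close> were nonempty, \<open>s\<close> would be the product of a
      move, which \<open>Del_Move\<close> excludes for a deleted token.\<close>
    have "out c s = Del \<Longrightarrow> u = [] \<and> s = a"
      using sw Del_Move[of c s] by (cases u) (auto split: option.splits outcome.splits)
    then show ?thesis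
      using sw stops.stuck[OF sw] stops.put[OF sw] stops.del
      by (cases "out c s") (auto, blast+)
  qed
qed auto

lemma rev_rmul_iff:
  "v = rev (rmul out (rev u) a) \<longleftrightarrow> stops a u v \<or> (\<exists>s ms. sweep a u = Some (s, ms) \<and> v = s # ms)"
  using stops_or_sweeps[of a u] rmul_stops[of a u _ "[]"] rmul_sweep[of a u _ _ "[]"] by fastforce

text \<open>
  \<open>tr a\<close> reads a padded pair from the left although the token \<open>a\<close> moves from the right: it guesses where the token
  stops. In phase \<open>Carry s p\<close> the token has to enter the part already read as \<open>s\<close>, and \<open>p\<close> is the letter due next in
  the second component, which lags one position behind.
\<close>

definition tr :: "'a \<Rightarrow> 'a phase \<Rightarrow> 'a option \<times> 'a option \<Rightarrow> 'a phase set" where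
  "tr a q b =
     (case (q, b) of
        (Diag, (Some x, Some x')) \<Rightarrow>
          (if x = x' then insert Diag {Carry s s |s. s \<in> A \<and> out x s = Stuck} else {})
            \<union> {Carry s r |s r. s \<in> A \<and> out x s = Put x' r}
      | (Diag, (Some x, None)) \<Rightarrow> if out x a = Del then {Done} else {}
      | (Carry s p, (Some x, Some p')) \<Rightarrow> if p = p' then {Carry t m |t m. t \<in> A \<and> out x t = Move s m} else {}
      | (Carry s p, (None, Some p')) \<Rightarrow> if s = a \<and> p = p' then {Done} else {}
      | _ \<Rightarrow> {})"

lemma tr_Done [simp]: "tr a Done b = {}"
  by (auto simp: tr_def split: option.splits prod.splits)

lemma npath_Done [simp]: "npath (tr a) Done w r \<longleftrightarrow> w = [] \<and> r = Done"
  by (cases w) auto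

lemma sweep_closed: "sweep a x = Some (s, ms) \<Longrightarrow> a \<in> A \<Longrightarrow> x \<in> lists A \<Longrightarrow> s \<in> A \<and> ms \<in> lists A"
proof (induction x arbitrary: s ms)
  case (Cons y x)
  then obtain t ns m where *: "sweep a x = Some (t, ns)" "out y t = Move s m" "ms = m # ns"
    by (auto split: option.splits outcome.splits)
  then have "t \<in> A \<and> ns \<in> lists A" using Cons by auto
  then show ?case using closed[of y t] * Cons.prems by auto
qed auto

text \<open>The trail is as long as the swept word, so together with the pending letter
  \<open>p\<close> the second word is longer by one. Its last letter is read against padding, and
  there the guessed token must be the actual \<open>a\<close>.\<close>

lemma npath_Carry:
  assumes "a \<in> A" "w \<in> lists (pad_alph A)"
  shows "npath (tr a) (Carry s p) w Done \<longleftrightarrow>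
    (\<exists>x ms. x \<in> lists A \<and> sweep a x = Some (s, ms) \<and> w = pad_conv x (p # ms))"
  using assms(2)
proof (induction w arbitrary: s p)
  case Nil
  have "[] \<noteq> pad_conv x (p # ms)" for x ms by (cases x) auto
  then show ?case by auto
next
  case (Cons b w)
  have bA: "w \<in> lists (pad_alph A)" and IH: "\<And>s p. npath (tr a) (Carry s p) w Done \<longleftrightarrow>
    (\<exists>x ms. x \<in> lists A \<and> sweep a x = Some (s, ms) \<and> w = pad_conv x (p # ms))"
    using Cons by auto
  obtain b1 b2 where b: "b = (b1, b2)" by (cases b)
  show ?case
  proof
    assume "npath (tr a) (Carry s p) (b # w) Done"
    then obtain q where q: "q \<in> tr a (Carry s p) b" "npath (tr a) q w Done" by auto
    show "\<exists>x ms. x \<in> lists A \<and> sweep a x = Some (s, ms) \<and> b # w = pad_conv x (p # ms)"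
    proof (cases b1)
      case None
      then have "s = a" "b2 = Some p" "q = Done"
        using q(1) by (auto simp: b tr_def split: option.splits if_splits)
      then show ?thesis using q(2) b None by (intro exI[of _ "[]"]) auto
    next
      case (Some y)
      then obtain t m where t: "q = Carry t m" "t \<in> A" "out y t = Move s m" "b2 = Some p"
        using q(1) by (auto simp: b tr_def split: option.splits if_splits)
      then obtain x ms where "x \<in> lists A" "sweep a x = Some (t, ms)" "w = pad_conv x (m # ms)"
        using q(2) IH by blast
      moreover have "y \<in> A" using Cons.hyps(1) unfolding b Some pad_alph_def by blast
      ultimately show ?thesis using t b Some by (intro exI[of _ "y # x"] exI[of _ "m # ms"]) auto
    qed
  next
    assume "\<exists>x ms. x \<in> lists A \<and> sweep a x = Some (s, ms) \<and> b # w = pad_conv x (p # ms)"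
    then obtain x ms where x: "x \<in> lists A" "sweep a x = Some (s, ms)" "b # w = pad_conv x (p # ms)"
      by blast
    show "npath (tr a) (Carry s p) (b # w) Done"
    proof (cases x)
      case Nil
      then show ?thesis using x by (auto simp: tr_def)
    next
      case (Cons y x')
      then obtain t ns m where t: "sweep a x' = Some (t, ns)" "out y t = Move s m" "ms = m # ns"
        using x by (auto split: option.splits outcome.splits)
      then have "t \<in> A" using sweep_closed assms x Cons by auto
      moreover have "npath (tr a) (Carry t m) w Done"
        using IH t x Cons by auto
      ultimately show ?thesis using x t Cons by (auto simp: tr_def)
    qed
  qed
qed

text \<open>The four kinds of transitions from \<open>Diag\<close> correspond to the four rules of
  \<open>stops\<close>.\<close>

lemma npath_Diag:
  assumes "a \<in> A" "w \<in> lists (pad_alph A)"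
  shows "npath (tr a) Diag w Done \<longleftrightarrow> (\<exists>u v. u \<in> lists A \<and> stops a u v \<and> w = pad_conv u v)"
  using assms(2)
proof (induction w)
  case Nil
  have "[] \<noteq> pad_conv u v" if "stops a u v" for u v
    using that by cases auto
  then show ?case by auto
next
  case (Cons b w)
  note carry = npath_Carry[OF assms(1), of w]
  have IH: "npath (tr a) Diag w Done \<longleftrightarrow> (\<exists>u v. u \<in> lists A \<and> stops a u v \<and> w = pad_conv u v)"
    and w: "w \<in> lists (pad_alph A)"
    using Cons by auto
  obtain b1 b2 where b: "b = (b1, b2)" by (cases b)
  show ?case
  proof
    assume "npath (tr a) Diag (b # w) Done"
    then obtain q where q: "q \<in> tr a Diag b" "npath (tr a) q w Done" by auto
    then obtain x where b1: "b1 = Some x" by (auto simp: b tr_def split: option.splits)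
    have xA: "x \<in> A" using Cons.hyps(1) unfolding b b1 pad_alph_def by blast
    consider "b2 = None" "out x a = Del" "q = Done" | "b2 = Some x" "q = Diag"
      | s where "b2 = Some x" "q = Carry s s" "out x s = Stuck"
      | s r x' where "b2 = Some x'" "q = Carry s r" "out x s = Put x' r"
      using q(1) b1 by (auto simp: b tr_def split: option.splits if_splits)
    then show "\<exists>u v. u \<in> lists A \<and> stops a u v \<and> b # w = pad_conv u v"
    proof cases
      case 1
      then show ?thesis using q(2) xA b b1 stops.del by (intro exI[of _ "[x]"] exI[of _ "[]"]) auto
    next
      case 2
      then obtain u v where "u \<in> lists A" "stops a u v" "w = pad_conv u v" using q(2) IH by blast
      then show ?thesis using 2 xA b b1 stops.step
        by (intro exI[of _ "x # u"] exI[of _ "x # v"]) auto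
    next
      case 3
      then obtain u ms where "u \<in> lists A" "sweep a u = Some (s, ms)" "w = pad_conv u (s # ms)"
        using q(2) carry w by blast
      then show ?thesis using 3 xA b b1 stops.stuck
        by (intro exI[of _ "x # u"] exI[of _ "x # s # ms"]) auto
    next
      case 4
      then obtain u ms where "u \<in> lists A" "sweep a u = Some (s, ms)" "w = pad_conv u (r # ms)"
        using q(2) carry w by blast
      then show ?thesis using 4 xA b b1 stops.put
        by (intro exI[of _ "x # u"] exI[of _ "x' # r # ms"]) auto
    qed
  next
    assume "\<exists>u v. u \<in> lists A \<and> stops a u v \<and> b # w = pad_conv u v"
    then obtain u v where uv: "u \<in> lists A" "stops a u v" "b # w = pad_conv u v" by blast
    from uv(2) show "npath (tr a) Diag (b # w) Done"
    proof cases
      case (stuck x s ms c)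
      then have "s \<in> A" "npath (tr a) (Carry s s) w Done"
        using sweep_closed assms uv carry w by auto
      then show ?thesis using stuck uv by (auto simp: tr_def)
    next
      case (put x s ms c r1 r2)
      then have "s \<in> A" "npath (tr a) (Carry s r2) w Done"
        using sweep_closed assms uv carry w by auto
      then show ?thesis using put uv by (auto simp: tr_def)
    next
      case (del c)
      then show ?thesis using uv by (auto simp: tr_def)
    next
      case (step u' v' c)
      then have "npath (tr a) Diag w Done" using IH uv by auto
      then show ?thesis using step uv by (auto simp: tr_def)
    qed
  qed
qed

lemma stops_closed:
  assumes "stops a u v" "a \<in> A" "u \<in> lists A"
  shows "v \<in> lists A"
proof -
  have "rev v = rmul out (rev u) a" using rmul_stops[OF assms(1), of "[]"] by simp
  then show ?thesis using rmul_lists[of "rev u" a] assms by (metis in_lists_conv_set set_rev)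
qed

lemma inj_pad_conv: "pad_conv u v = pad_conv u' v' \<Longrightarrow> u = u' \<and> v = v'"
proof (induction u arbitrary: v u' v')
  case Nil
  then show ?case
  proof (induction v arbitrary: u' v')
    case Nil
    then show ?case by (cases u'; cases v') auto
  next
    case (Cons y v)
    then show ?case by (cases u'; cases v') auto
  qed
next
  case (Cons x u)
  then show ?case by (cases v; cases u'; cases v') auto
qed

lemma sync_recognisable_rmul:
  assumes a: "a \<in> A"
  shows "sync_recognisable A {(u, v). u \<in> reps \<and> v = nf (u @ [a])}"
proof -
  \<comment> \<open>\<open>Diag\<close> covers tokens that stop inside the word. Starting in
    \<open>Carry s s\<close> covers a token that sweeps the whole word and becomes its new first
    letter \<open>s\<close>.\<close>
  define I where "I = insert Diag {Carry s s |s. s \<in> A}"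
  define K where "K = {w \<in> lists (pad_alph A). \<exists>q\<in>I. \<exists>r\<in>{Done}. npath (tr a) q w r}"
  define Q where "Q = {Diag, Done} \<union> (\<lambda>(s, p). Carry s p) ` (A \<times> A)"
  have *: "w \<in> K \<longleftrightarrow> (\<exists>u v. u \<in> lists A \<and> v \<in> lists A \<and> v = rev (rmul out (rev u) a) \<and> w = pad_conv u v)"
    (is "_ \<longleftrightarrow> ?R") for w
  proof
    assume "w \<in> K"
    then have w: "w \<in> lists (pad_alph A)" "npath (tr a) Diag w Done \<or> (\<exists>s\<in>A. npath (tr a) (Carry s s) w Done)"
      by (auto simp: K_def I_def)
    from this(2) show ?R
    proof (elim disjE bexE)
      assume "npath (tr a) Diag w Done"
      then show ?R using npath_Diag[OF a w(1)] rev_rmul_iff stops_closed a by blast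
    next
      fix s assume "s \<in> A" "npath (tr a) (Carry s s) w Done"
      then obtain x ms where "x \<in> lists A" "sweep a x = Some (s, ms)" "w = pad_conv x (s # ms)"
        using npath_Carry[OF a w(1)] by blast
      note x = this
      have "s # ms \<in> lists A" using sweep_closed[OF x(2) a x(1)] by simp
      moreover have "s # ms = rev (rmul out (rev x) a)" unfolding rev_rmul_iff using x(2) by blast
      ultimately show ?R using x by metis
    qed
  next
    assume ?R
    then obtain u v where uv: "u \<in> lists A" "v \<in> lists A" "v = rev (rmul out (rev u) a)" "w = pad_conv u v"
      by blast
    have w: "w \<in> lists (pad_alph A)" unfolding uv(4) using uv(1,2) by (rule pad_conv_in_lists)
    from uv(3) have "stops a u v \<or> (\<exists>s ms. sweep a u = Some (s, ms) \<and> v = s # ms)"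
      unfolding rev_rmul_iff .
    then have "\<exists>q\<in>I. npath (tr a) q w Done"
    proof (elim disjE exE conjE)
      assume "stops a u v"
      then have "npath (tr a) Diag w Done" using npath_Diag[OF a w] uv(1,4) by metis
      then show ?thesis by (simp add: I_def)
    next
      fix s ms assume "sweep a u = Some (s, ms)" "v = s # ms"
      then have "npath (tr a) (Carry s s) w Done" "s \<in> A"
        using npath_Carry[OF a w] uv(1,4) sweep_closed[OF _ a uv(1)] by metis+
      then show ?thesis by (auto simp: I_def)
    qed
    then show "w \<in> K" using w by (simp add: K_def)
  qed
  show ?thesis
  proof (rule sync_recognisable_if_nfa)
    show "recognisable (pad_alph A) K"
    proof (rule recognisable_nfa[OF _ _ _ K_def])
      show "finite Q" using fin by (simp add: Q_def)
      show "I \<subseteq> Q" by (auto simp: I_def Q_def)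
      show "tr a q b \<subseteq> Q" if "q \<in> Q" "b \<in> pad_alph A" for q b
      proof -
        have Move: "m \<in> A" if "out x t = Move s m" "x \<in> A" "t \<in> A" for x t s m
          using that closed[of x t] by simp
        have Put: "r \<in> A" if "out x t = Put r' r" "x \<in> A" "t \<in> A" for x t r' r
          using that closed[of x t] by simp
        obtain b1 b2 where b: "b = (b1, b2)" by (cases b)
        show ?thesis
          using that unfolding b
          by (cases q; cases b1; cases b2) (auto simp: tr_def Q_def pad_alph_def dest: Move Put)
      qed
    qed
    show "pad_conv u v \<in> K \<longleftrightarrow> v = rev (rmul out (rev u) a)" if "u \<in> lists A" "v \<in> lists A" for u v
      using * that inj_pad_conv by blast
    show "\<exists>u\<in>lists A. \<exists>v\<in>lists A. p = pad_conv u v" if "p \<in> K" for p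
      using * that by blast
    have "nf (u @ [a]) = rev (rmul out (rev u) a) \<and> nf (u @ [a]) \<in> lists A" if "u \<in> reps" for u
      using that reps_lists[OF that] a nf_lists[of "u @ [a]"] by (simp add: nf_snoc nf_reps)
    then show "{(u, v). u \<in> reps \<and> v = nf (u @ [a])} =
        {(u, v). u \<in> reps \<and> v \<in> lists A \<and> v = rev (rmul out (rev u) a)}" by auto
  qed
qed

lemma sync_recognisable_Id: "sync_recognisable A {(u, v). u \<in> reps \<and> v = u}"
proof -
  \<comment> \<open>The pair \<open>(None, None)\<close> lies in the padded alphabet but occurs in
    no convolution, so it has to be rejected.\<close>
  define d where "d = (\<lambda>(q :: unit) b. if fst b = snd b \<and> fst b \<noteq> (None :: 'a option) then {()} else {})"
  define K where "K = {w \<in> lists (pad_alph A). \<exists>q\<in>{()}. \<exists>r\<in>{()}. npath d q w r}"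
  have *: "npath d () w () \<longleftrightarrow> (\<exists>u\<in>lists A. w = pad_conv u u)" if "w \<in> lists (pad_alph A)" for w
    using that
  proof (induction w)
    case Nil
    then show ?case by (auto intro!: bexI[of _ "[]"])
  next
    case (Cons b w)
    show ?case
    proof
      assume "npath d () (b # w) ()"
      then obtain x u where b: "b = (Some x, Some x)" "u \<in> lists A" "w = pad_conv u u"
        using Cons by (cases b) (auto simp: d_def split: if_splits)
      moreover have "x \<in> A" using Cons.hyps(1) unfolding b(1) pad_alph_def by blast
      ultimately show "\<exists>u\<in>lists A. b # w = pad_conv u u"
        using Cons.prems by (intro bexI[of _ "x # u"]) (auto simp: pad_alph_def)
    next
      assume "\<exists>u\<in>lists A. b # w = pad_conv u u"
      then obtain u where u: "u \<in> lists A" "b # w = pad_conv u u" by blast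
      then show "npath d () (b # w) ()" using Cons by (cases u) (auto simp: d_def)
    qed
  qed
  show ?thesis
  proof (rule sync_recognisable_if_nfa)
    show "recognisable (pad_alph A) K"
      by (rule recognisable_nfa[OF _ _ _ K_def, where Q = UNIV]) auto
    show "pad_conv u v \<in> K \<longleftrightarrow> v = u" if "u \<in> lists A" "v \<in> lists A" for u v
      using *[of "pad_conv u v"] pad_conv_in_lists[OF that] that inj_pad_conv[of u v]
      by (auto simp: K_def)
    show "\<exists>u\<in>lists A. \<exists>v\<in>lists A. p = pad_conv u v" if "p \<in> K" for p
      using *[of p] that by (auto simp: K_def)
    show "{(u, v). u \<in> reps \<and> v = u} = {(u, v). u \<in> reps \<and> v \<in> lists A \<and> v = u}"
      using reps_lists by auto
  qed
qed

end

section \<open>The monoid of normal forms, with elements coded as natural numbers\<close>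

locale nat_sliding = sliding A out for A :: "nat set" and out
begin

definition sigma :: "nat list \<Rightarrow> nat" where
  "sigma w = list_encode (nf w)"

definition S :: "nat monoid" where
  "S = \<lparr>carrier = list_encode ` reps, mult = (\<lambda>s t. sigma (list_decode s @ list_decode t)),
        one = list_encode []\<rparr>"

lemma sigma_eq_iff: "sigma u = sigma v \<longleftrightarrow> nf u = nf v"
  unfolding sigma_def by (metis list_encode_inverse)

lemma sigma_mult: "u \<in> lists A \<Longrightarrow> v \<in> lists A \<Longrightarrow> sigma u \<otimes>\<^bsub>S\<^esub> sigma v = sigma (u @ v)"
  by (simp add: S_def sigma_def nf_append)

lemma sigma_Nil: "sigma [] = \<one>\<^bsub>S\<^esub>"
  by (simp add: S_def sigma_def)

lemma sigma_carrier: "w \<in> lists A \<Longrightarrow> sigma w \<in> carrier S"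
  by (simp add: S_def sigma_def nf_in_reps)

lemma sigma_reps: "sigma ` reps = carrier S"
  by (auto simp: S_def sigma_def nf_reps image_iff)

lemma sigma_lists: "sigma ` lists A = carrier S"
  using sigma_reps sigma_carrier reps_lists by blast

lemma word_morphism_sigma: "word_morphism S A sigma"
  by (auto simp: word_morphism_def sigma_mult sigma_Nil sigma_carrier)

lemma carrier_cases:
  assumes "x \<in> carrier S"
  obtains u where "x = sigma u" "u \<in> lists A"
  using assms unfolding sigma_lists[symmetric] by (rule imageE)

lemma monoid_S: "monoid S"
proof (rule monoidI)
  fix x y z
  assume "x \<in> carrier S" "y \<in> carrier S" "z \<in> carrier S"
  then obtain u v w where u: "x = sigma u" "y = sigma v" "z = sigma w"
    and A: "u \<in> lists A" "v \<in> lists A" "w \<in> lists A"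
    by (elim carrier_cases)
  have A': "u @ v \<in> lists A" "v @ w \<in> lists A" using A by auto
  show "x \<otimes>\<^bsub>S\<^esub> y \<in> carrier S"
    unfolding u sigma_mult[OF A(1,2)] using A'(1) by (rule sigma_carrier)
  show "x \<otimes>\<^bsub>S\<^esub> y \<otimes>\<^bsub>S\<^esub> z = x \<otimes>\<^bsub>S\<^esub> (y \<otimes>\<^bsub>S\<^esub> z)"
    unfolding u sigma_mult[OF A(1,2)] sigma_mult[OF A(2,3)] sigma_mult[OF A'(1) A(3)]
      sigma_mult[OF A(1) A'(2)] by simp
next
  show "\<one>\<^bsub>S\<^esub> \<in> carrier S" using sigma_carrier[of "[]"] by (simp add: sigma_Nil)
next
  fix x assume "x \<in> carrier S"
  then obtain u where "x = sigma u" "u \<in> lists A" by (rule carrier_cases)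
  then show "\<one>\<^bsub>S\<^esub> \<otimes>\<^bsub>S\<^esub> x = x" "x \<otimes>\<^bsub>S\<^esub> \<one>\<^bsub>S\<^esub> = x"
    using sigma_mult[of "[]" u] sigma_mult[of u "[]"] by (simp_all add: sigma_Nil)
qed

lemma finitely_presented_S: "finitely_presented S"
  unfolding finitely_presented_def
  using fin rules_finite rules_lists word_morphism_sigma sigma_lists sigma_eq_iff nf_eq_iff
  by (intro exI[of _ A] exI[of _ rules] exI[of _ sigma]) simp

lemma automatic_S:
  "automatic_structure S A reps {(u, v). u \<in> reps \<and> v = u}
     (\<lambda>a. {(u, v). u \<in> reps \<and> v = nf (u @ [a])}) sigma"
proof -
  have "nf (u @ [a]) \<in> reps" if "u \<in> reps" "a \<in> A" for u a
    using that reps_lists[of u] by (intro nf_in_reps) auto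
  then show ?thesis
    unfolding automatic_structure_def sigma_eq_iff
    using fin recognisable_reps sync_recognisable_Id sync_recognisable_rmul word_morphism_sigma
      sigma_reps by (auto simp: nf_reps)
qed

text \<open>Every element is \<open>sigma v\<close> for some word \<open>v\<close>, and the identity
  has the empty normal form: right inverses are given by the words that erase
  \<open>w\<close>.\<close>

lemma has_right_inverse_sigma:
  assumes "w \<in> lists A"
  shows "has_right_inverse S (sigma w) \<longleftrightarrow> (\<exists>v\<in>lists A. nf (w @ v) = [])"
  unfolding has_right_inverse_def sigma_lists[symmetric]
  using assms sigma_eq_iff[of _ "[]"] by (auto simp: sigma_mult sigma_Nil[symmetric])

end

section \<open>Counter programs in a monoid\<close>

datatype instr = Inc nat | Loop nat "instr list"

instance instr :: countable by countable_datatype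

type_synonym config = "instr list \<times> (nat \<Rightarrow> nat)"

fun nxt :: "config \<Rightarrow> config" where
  "nxt ([], s) = ([], s)"
| "nxt (Inc j # P, s) = (P, s(j := Suc (s j)))"
| "nxt (Loop j B # P, s) = (if s j = 0 then (P, s) else (B @ Loop j B # P, s(j := s j - 1)))"

definition halts :: "config \<Rightarrow> bool" where
  "halts c \<longleftrightarrow> (\<exists>n. fst ((nxt ^^ n) c) = [])"

lemma halts_Nil [simp]: "halts ([], s)"
  unfolding halts_def by (rule exI[of _ 0]) simp

lemma halts_nxt: "halts (nxt c) \<longleftrightarrow> halts c"
proof
  assume "halts (nxt c)"
  then obtain n where "fst ((nxt ^^ n) (nxt c)) = []" unfolding halts_def by blast
  then show "halts c" unfolding halts_def by (intro exI[of _ "Suc n"]) (simp add: funpow_swap1)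
next
  assume "halts c"
  then obtain n where n: "fst ((nxt ^^ n) c) = []" unfolding halts_def by blast
  then show "halts (nxt c)"
  proof (cases n)
    case 0
    then have "nxt c = c" using n by (cases c) auto
    then show ?thesis using \<open>halts c\<close> by simp
  next
    case (Suc m)
    then show ?thesis using n unfolding halts_def by (intro exI[of _ m]) (simp add: funpow_swap1)
  qed
qed

text \<open>The control state is the program that remains to be run. This finite set contains
  \<open>P\<close> and is closed under taking machine steps, which keeps the set of state letters
  finite.\<close>

fun conts :: "instr list \<Rightarrow> instr list set" where
  "conts [] = {[]}"
| "conts (Inc j # P) = insert (Inc j # P) (conts P)"
| "conts (Loop j B # P) = insert (Loop j B # P) (conts P \<union> (\<lambda>C. C @ Loop j B # P) ` conts B)"

fun vars :: "instr list \<Rightarrow> nat set" where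
  "vars [] = {}"
| "vars (Inc j # P) = insert j (vars P)"
| "vars (Loop j B # P) = insert j (vars B \<union> vars P)"

lemma finite_conts: "finite (conts P)"
  by (induction P rule: conts.induct) auto

lemma finite_vars: "finite (vars P)"
  by (induction P rule: vars.induct) auto

lemma self_conts: "P \<in> conts P"
  by (cases P rule: conts.cases) auto

lemma conts_Inc: "Inc j # Q \<in> conts P \<Longrightarrow> Q \<in> conts P \<and> j \<in> vars P"
proof (induction P arbitrary: Q rule: conts.induct)
  case (3 i B P)
  from 3(3) consider "Inc j # Q \<in> conts P" | C where "C \<in> conts B" "Inc j # Q = C @ Loop i B # P"
    by auto
  then show ?case
  proof cases
    case 2
    then obtain C' where "C = Inc j # C'" "Q = C' @ Loop i B # P" by (cases C) auto
    then show ?thesis using 2 3(2)[of C'] by auto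
  qed (use 3 in auto)
qed (auto simp: self_conts)

lemma conts_Loop:
  "Loop j D # Q \<in> conts P \<Longrightarrow> Q \<in> conts P \<and> D @ Loop j D # Q \<in> conts P \<and> j \<in> vars P"
proof (induction P arbitrary: Q rule: conts.induct)
  case (3 i B P)
  from 3(3) consider "Loop j D # Q = Loop i B # P" | "Loop j D # Q \<in> conts P"
    | C where "C \<in> conts B" "Loop j D # Q = C @ Loop i B # P"
    by auto
  then show ?case
  proof cases
    case 1
    then show ?thesis using self_conts[of B] self_conts[of P] by auto
  next
    case 2
    then show ?thesis using 3 by auto
  next
    case 3
    show ?thesis
    proof (cases C)
      case Nil
      then show ?thesis using 3 self_conts[of B] self_conts[of P] by auto
    next
      case (Cons c C')
      then have C: "C = Loop j D # C'" "Q = C' @ Loop i B # P" using 3 by auto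
      then have "C' \<in> conts B" "D @ Loop j D # C' \<in> conts B" "j \<in> vars B"
        using "3.IH"(2)[of C'] 3 by auto
      then show ?thesis using C by force
    qed
  qed
qed auto

text \<open>A token \<open>Sub j\<close> continues as \<open>Subbed j\<close> once it has replaced a letter \<open>Ctr j\<close> by a blank.\<close>

datatype op = Add nat | Sub nat | Subbed nat | Zero_test nat | Halt

instance op :: countable by countable_datatype

datatype letter = St "instr list" | Ctr nat | Blank | End | Dead | Eraser | Start op | Run op

instance letter :: countable by countable_datatype

fun arrive :: "instr list \<Rightarrow> op \<Rightarrow> letter outcome" where
  "arrive (Inc j # P) (Add i) = (if i = j then Put (St P) (Ctr j) else Stuck)"
| "arrive (Loop j B # P) (Subbed i) = (if i = j then Put (St (B @ Loop j B # P)) Blank else Stuck)"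
| "arrive (Loop j B # P) (Zero_test i) = (if i = j then Put (St P) Blank else Stuck)"
| "arrive [] Halt = Put Dead Dead"
| "arrive _ _ = Stuck"

text \<open>\<open>End\<close> reacts only to \<open>Start\<close> letters, so every operation
  enters at the right end. In a configuration, \<open>Sub j\<close> gets stuck if there is no
  \<open>Ctr j\<close>, and \<open>Zero_test j\<close> if there is one. \<open>Subbed j\<close>
  cannot be started directly, since this would enter a loop body without a decrement.
  \<open>Halt\<close> turns all it passes into \<open>Dead\<close>.\<close>

fun out :: "letter \<Rightarrow> letter \<Rightarrow> letter outcome" where
  "out End (Start p) =
     (case p of Subbed j \<Rightarrow> Stuck | Halt \<Rightarrow> Move (Run Halt) Dead | _ \<Rightarrow> Move (Run p) End)"
| "out (Ctr i) (Run p) =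
     (case p of
        Sub j \<Rightarrow> if i = j then Move (Run (Subbed j)) Blank else Move (Run p) (Ctr i)
      | Zero_test j \<Rightarrow> if i = j then Stuck else Move (Run p) (Ctr i)
      | Halt \<Rightarrow> Move (Run p) Dead
      | _ \<Rightarrow> Move (Run p) (Ctr i))"
| "out Blank (Run p) = Move (Run p) (if p = Halt then Dead else Blank)"
| "out (St P) (Run p) = arrive P p"
| "out Dead Eraser = Del"
| "out _ _ = Stuck"

fun active :: "letter \<Rightarrow> bool" where
  "active Eraser = True"
| "active (Start p) = True"
| "active (Run p) = True"
| "active _ = False"

lemma inert_if_inactive: "\<not> active y \<Longrightarrow> out x y = Stuck"
  by (cases y; cases x) auto

lemma active_left: "active x \<Longrightarrow> out x y = Stuck"
  by (cases x) auto

lemma arrive_cases: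
  obtains "arrive P p = Stuck"
  | j Q where "P = Inc j # Q" "p = Add j" "arrive P p = Put (St Q) (Ctr j)"
  | j B Q where "P = Loop j B # Q" "p = Subbed j" "arrive P p = Put (St (B @ P)) Blank"
  | j B Q where "P = Loop j B # Q" "p = Zero_test j" "arrive P p = Put (St Q) Blank"
  | "P = []" "p = Halt" "arrive P p = Put Dead Dead"
  by (atomize_elim, cases "(P, p)" rule: arrive.cases) auto

lemma arrive_neq [simp]: "arrive P p \<noteq> Move t m" "arrive P p \<noteq> Del"
  by (rule arrive_cases[of P p]; simp)+

lemma out_Move: "out x y = Move t m \<Longrightarrow> (\<exists>p. t = Run p) \<and> \<not> active m"
  by (cases "(x, y)" rule: out.cases) (auto split: op.splits if_splits)

lemma out_Put: "out x y = Put a b \<Longrightarrow> \<exists>P p. x = St P \<and> y = Run p \<and> arrive P p = Put a b"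
  by (cases "(x, y)" rule: out.cases) (auto split: op.splits if_splits)

lemma out_Del: "out x y = Del \<Longrightarrow> y = Eraser"
  by (cases "(x, y)" rule: out.cases) (auto split: op.splits if_splits)

lemma arrive_Put: "arrive P p = Put a b \<Longrightarrow> \<not> active a \<and> \<not> active b"
  by (rule arrive_cases[of P p]) auto

definition ops :: "nat set \<Rightarrow> op set" where
  "ops J = insert Halt (Add ` J \<union> Sub ` J \<union> Subbed ` J \<union> Zero_test ` J)"

text \<open>Counter \<open>0\<close> is always included because it holds the input, even if the
  program does not mention it.\<close>

definition letters :: "instr list \<Rightarrow> letter set" where
  "letters P = {Blank, End, Dead, Eraser} \<union> St ` conts P \<union> Ctr ` insert 0 (vars P)
     \<union> Start ` ops (vars P) \<union> Run ` ops (vars P)"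

lemma finite_letters: "finite (letters P)"
  by (simp add: letters_def ops_def finite_conts finite_vars)

lemma out_letters:
  assumes "x \<in> letters P" "y \<in> letters P"
  shows "set (rhs (out x y)) \<subseteq> letters P"
proof (cases "(x, y)" rule: out.cases)
  case (4 Q p)
  then have Q: "Q \<in> conts P" "p \<in> ops (vars P)" using assms by (auto simp: letters_def)
  show ?thesis
  proof (cases rule: arrive_cases[of Q p])
    case (2 j R)
    then show ?thesis using 4 conts_Inc[of j R P] Q by (auto simp: letters_def)
  next
    case (3 j B R)
    then show ?thesis using 4 conts_Loop[of j B R P] Q by (auto simp: letters_def)
  next
    case (4 j B R)
    then show ?thesis using \<open>(x, y) = _\<close> conts_Loop[of j B R P] Q by (auto simp: letters_def)
  qed (use 4 in \<open>auto simp: letters_def\<close>)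
qed (use assms in \<open>auto simp: letters_def ops_def split: op.splits\<close>)

section \<open>Configurations as words and single machine steps\<close>

definition mobile :: "letter list \<Rightarrow> bool" where
  "mobile x \<longleftrightarrow> set x \<subseteq> insert Blank (range Ctr)"

lemma mobile_simps [simp]:
  "mobile []"
  "mobile (a # x) \<longleftrightarrow> (a = Blank \<or> (\<exists>j. a = Ctr j)) \<and> mobile x"
  "mobile (x @ y) \<longleftrightarrow> mobile x \<and> mobile y"
  by (auto simp: mobile_def)

definition stuck :: "letter list \<Rightarrow> bool" where
  "stuck z \<longleftrightarrow> (\<exists>c\<in>set z. active c)"

text \<open>An active letter is never the left letter of a redex, so no later token can change, pass
  or erase it.\<close>

lemma stuck_rmul:
  assumes "stuck z"
  shows "stuck (rmul out z y)"
proof -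
  have "c \<in> set z \<Longrightarrow> active c \<Longrightarrow> c \<in> set (rmul out z y)" for c
    by (induction z arbitrary: y) (auto split: outcome.splits simp: active_left)
  then show ?thesis using assms unfolding stuck_def by blast
qed

lemma stuck_simps [simp]: "stuck (a # z) \<longleftrightarrow> active a \<or> stuck z" "stuck (x @ z) \<longleftrightarrow> stuck x \<or> stuck z"
  by (auto simp: stuck_def)

lemma rmul_Add: "mobile x \<Longrightarrow> rmul out (x @ z) (Run (Add j)) = x @ rmul out z (Run (Add j))"
  by (induction x) auto

lemma rmul_Subbed: "mobile x \<Longrightarrow> rmul out (x @ z) (Run (Subbed j)) = x @ rmul out z (Run (Subbed j))"
  by (induction x) auto

lemma rmul_Zero_test:
  "mobile x \<Longrightarrow> count_list x (Ctr j) = 0 \<Longrightarrow>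
     rmul out (x @ z) (Run (Zero_test j)) = x @ rmul out z (Run (Zero_test j))"
  by (induction x) (auto split: if_splits)

lemma rmul_Zero_test_stuck:
  "mobile x \<Longrightarrow> count_list x (Ctr j) \<noteq> 0 \<Longrightarrow> stuck (rmul out (x @ z) (Run (Zero_test j)))"
  by (induction x) (auto split: if_splits)

lemma rmul_Sub_zero:
  "mobile x \<Longrightarrow> count_list x (Ctr j) = 0 \<Longrightarrow>
     rmul out (x @ z) (Run (Sub j)) = x @ rmul out z (Run (Sub j))"
  by (induction x) (auto split: if_splits)

text \<open>The witness is \<open>x\<close> with the first \<open>Ctr j\<close> that the token meets
  replaced by a blank. From there on the token is \<open>Subbed j\<close> and passes all mobile
  letters unchanged.\<close>

lemma rmul_Sub:
  assumes "mobile x" "count_list x (Ctr j) \<noteq> 0"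
  shows "\<exists>x'. mobile x' \<and> length x' = length x \<and> count_list x' (Ctr j) = count_list x (Ctr j) - 1 \<and>
    (\<forall>i. i \<noteq> j \<longrightarrow> count_list x' (Ctr i) = count_list x (Ctr i)) \<and>
    rmul out (x @ z) (Run (Sub j)) = x' @ rmul out z (Run (Subbed j))"
  using assms
proof (induction x)
  case (Cons a x)
  show ?case
  proof (cases "a = Ctr j")
    case True
    then show ?thesis using Cons.prems
      by (intro exI[of _ "Blank # x"]) (auto simp: rmul_Subbed)
  next
    case False
    then obtain x' where "mobile x'" "length x' = length x" "count_list x' (Ctr j) = count_list x (Ctr j) - 1"
      "\<forall>i. i \<noteq> j \<longrightarrow> count_list x' (Ctr i) = count_list x (Ctr i)"
      "rmul out (x @ z) (Run (Sub j)) = x' @ rmul out z (Run (Subbed j))"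
      using Cons by auto
    then show ?thesis using Cons.prems False by (intro exI[of _ "a # x'"]) (auto split: if_splits)
  qed
qed simp

lemma rmul_Halt:
  "mobile x \<Longrightarrow> rmul out (x @ z) (Run Halt) = replicate (length x) Dead @ rmul out z (Run Halt)"
  by (induction x) auto

text \<open>As always with \<open>rmul\<close>, the word \<open>z\<close> is reversed:
  \<open>End\<close> comes first and the state letter last.\<close>

definition cfg :: "letter list \<Rightarrow> config \<Rightarrow> bool" where
  "cfg z c \<longleftrightarrow> (\<exists>x. z = End # x @ [St (fst c)] \<and> mobile x \<and> (\<forall>j. count_list x (Ctr j) = snd c j))"


lemma Inc_word:
  assumes "cfg z (Inc j # P, s)"
  shows "cfg (rmul out z (Start (Add j))) (nxt (Inc j # P, s))"
proof -
  obtain x where "z = End # x @ [St (Inc j # P)]" "mobile x" "\<forall>j. count_list x (Ctr j) = s j"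
    using assms by (auto simp: cfg_def)
  \<comment> \<open>The new letter is put directly to the right of the state letter, hence at the
    end of the reversed \<open>x\<close>.\<close>
  then show ?thesis unfolding cfg_def by (intro exI[of _ "x @ [Ctr j]"]) (auto simp: rmul_Add)
qed

lemma Loop_word_zero:
  assumes "cfg z (Loop j B # P, s)" "s j = 0"
  shows "cfg (rmul out z (Start (Zero_test j))) (nxt (Loop j B # P, s))"
proof -
  obtain x where "z = End # x @ [St (Loop j B # P)]" "mobile x" "\<forall>j. count_list x (Ctr j) = s j"
    using assms by (auto simp: cfg_def)
  then show ?thesis using assms(2) unfolding cfg_def
    by (intro exI[of _ "x @ [Blank]"]) (auto simp: rmul_Zero_test)
qed

lemma Loop_word_Suc:
  assumes "cfg z (Loop j B # P, s)" "s j \<noteq> 0"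
  shows "cfg (rmul out z (Start (Sub j))) (nxt (Loop j B # P, s))"
proof -
  obtain x where x: "z = End # x @ [St (Loop j B # P)]" "mobile x" "\<forall>j. count_list x (Ctr j) = s j"
    using assms by (auto simp: cfg_def)
  then obtain x' where "mobile x'" "count_list x' (Ctr j) = count_list x (Ctr j) - 1"
      "\<forall>i. i \<noteq> j \<longrightarrow> count_list x' (Ctr i) = count_list x (Ctr i)"
      "rmul out (x @ [St (Loop j B # P)]) (Run (Sub j)) = x' @ rmul out [St (Loop j B # P)] (Run (Subbed j))"
    using rmul_Sub[of x j "[St (Loop j B # P)]"] assms(2) by auto
  then show ?thesis using x assms(2) unfolding cfg_def
    by (intro exI[of _ "x' @ [Blank]"]) auto
qed

lemma foldl_Eraser: "foldl (rmul out) (replicate n Dead) (replicate n Eraser) = []"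
  by (induction n) auto

text \<open>The word \<open>w\<close> spells the operations of the run one after the other, then
  \<open>Start Halt\<close>, then one \<open>Eraser\<close> for each letter.\<close>

lemma erase_if_halts:
  assumes "halts c" "cfg z c" "fst c \<in> conts P"
  shows "\<exists>w\<in>lists (letters P). foldl (rmul out) z w = []"
proof -
  obtain n where "fst ((nxt ^^ n) c) = []" using assms(1) unfolding halts_def by blast
  then show ?thesis using assms(2,3)
  proof (induction n arbitrary: c z)
    case 0
    then obtain x where x: "z = End # x @ [St []]" "mobile x" by (auto simp: cfg_def)
    \<comment> \<open>Besides the letters of \<open>x\<close>, one \<open>Dead\<close> comes from
      \<open>End\<close> and two from the arrival at the state letter.\<close>
    have "rmul out z (Start Halt) = replicate (length x + 3) Dead"
    proof -
      have "Dead # replicate n Dead @ [Dead, Dead] = replicate (n + 3) Dead" for n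
        by (induction n) (auto simp: numeral_3_eq_3)
      then show ?thesis using x by (simp add: rmul_Halt)
    qed
    then have "foldl (rmul out) z (Start Halt # replicate (length x + 3) Eraser) = []"
      using foldl_Eraser[of "length x + 3"] by simp
    moreover have "Start Halt # replicate (length x + 3) Eraser \<in> lists (letters P)"
      by (auto simp: letters_def ops_def)
    ultimately show ?case by blast
  next
    case (Suc n)
    obtain Q s where c: "c = (Q, s)" by (cases c)
    have IH: ?case if "cfg (rmul out z y) (nxt c)" "y \<in> letters P" "fst (nxt c) \<in> conts P" for y
    proof -
      have "fst ((nxt ^^ n) (nxt c)) = []" using Suc.prems(1) by (simp add: funpow_swap1)
      from Suc.IH[OF this that(1,3)] obtain w where
        "w \<in> lists (letters P)" "foldl (rmul out) (rmul out z y) w = []" by blast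
      then show ?thesis using that(2) by (intro bexI[of _ "y # w"]) auto
    qed
    show ?case
    proof (cases Q rule: conts.cases)
      case 1
      \<comment> \<open>The machine has halted already, so the induction hypothesis applies to the
        same configuration.\<close>
      then have "nxt c = c" using c by simp
      then have "fst ((nxt ^^ n) c) = []" using Suc.prems(1) by (simp add: funpow_swap1)
      then show ?thesis using Suc by blast
    next
      case (2 j R)
      then have "R \<in> conts P" "j \<in> vars P" using Suc.prems(3) conts_Inc c by auto
      then show ?thesis using 2 c Suc.prems(2) Inc_word[of z j R s]
        by (intro IH[of "Start (Add j)"]) (auto simp: letters_def ops_def)
    next
      case (3 j B R)
      then have *: "R \<in> conts P" "B @ Loop j B # R \<in> conts P" "j \<in> vars P"
        using Suc.prems(3) conts_Loop c by auto
      show ?thesis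
      proof (cases "s j = 0")
        case True
        then show ?thesis using 3 c Suc.prems(2) Loop_word_zero[of z j B R s] *
          by (intro IH[of "Start (Zero_test j)"]) (auto simp: letters_def ops_def)
      next
        case False
        then show ?thesis using 3 c Suc.prems(2) Loop_word_Suc[of z j B R s] *
          by (intro IH[of "Start (Sub j)"]) (auto simp: letters_def ops_def)
      qed
    qed
  qed
qed

section \<open>No erasure without halting\<close>

text \<open>A \<open>Run\<close> token that gets through \<open>g\<close> stops in front of
  \<open>z\<close>, because \<open>End\<close> does not react to it.\<close>

lemma rmul_Run_append_cfg:
  assumes "cfg z c"
  shows "\<exists>g'. rmul out (g @ z) (Run p) = g' @ z"
proof (induction g arbitrary: p)
  case Nil
  then show ?case using assms by (auto simp: cfg_def intro: exI[of _ "[Run p]"])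
next
  case (Cons a g)
  show ?case
  proof (cases "out a (Run p)")
    case Stuck
    then show ?thesis by (intro exI[of _ "Run p # a # g"]) simp
  next
    case (Move t m)
    then obtain q where "t = Run q" using out_Move by blast
    then obtain g' where "rmul out (g @ z) t = g' @ z" using Cons by blast
    then show ?thesis using Move by (intro exI[of _ "m # g'"]) simp
  next
    case (Put b d)
    then show ?thesis by (intro exI[of _ "d # b # g"]) simp
  next
    case Del
    then show ?thesis by (intro exI[of _ g]) simp
  qed
qed

text \<open>With a letter on top of \<open>z\<close>, whatever moves past that letter is a
  \<open>Run\<close> token, from which \<open>z\<close> is safe. Thus a configuration stays intact
  as long as it is covered.\<close>

lemma rmul_append_cfg:
  assumes "cfg z c"
  shows "\<exists>g'. rmul out ((a # g) @ z) y = g' @ z"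
proof (cases "out a y")
  case Stuck
  then show ?thesis by (intro exI[of _ "y # a # g"]) simp
next
  case (Move t m)
  then obtain q where "t = Run q" using out_Move by blast
  then obtain g' where "rmul out (g @ z) t = g' @ z" using rmul_Run_append_cfg[OF assms] by blast
  then show ?thesis using Move by (intro exI[of _ "m # g'"]) simp
next
  case (Put b d)
  then show ?thesis by (intro exI[of _ "d # b # g"]) simp
next
  case Del
  then show ?thesis by (intro exI[of _ g]) simp
qed

text \<open>A letter that does not fit the next operation gets stuck inside or comes to rest on top
  of \<open>z\<close>; a fitting one performs exactly the step \<open>nxt\<close>. Only
  \<open>Start Halt\<close> at a halting state opens the way to erasure.\<close>

lemma rmul_cfg:
  assumes "cfg z c"
  shows "(fst c = [] \<and> y = Start Halt) \<or> stuck (rmul out z y) \<or> cfg (rmul out z y) (nxt c) \<or> rmul out z y = y # z"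
proof (cases "\<exists>p. y = Start p")
  case False
  then have "out End y = Stuck" by (cases y) auto
  then show ?thesis using assms by (auto simp: cfg_def)
next
  case True
  then obtain p where p: "y = Start p" by blast
  obtain P s where c: "c = (P, s)" by (cases c)
  obtain x where x: "z = End # x @ [St P]" "mobile x" "\<forall>j. count_list x (Ctr j) = s j"
    using assms c by (auto simp: cfg_def)
  show ?thesis
  proof (cases p)
    case (Add j)
    show ?thesis
    proof (cases rule: arrive_cases[of P p])
      case 2
      then show ?thesis using Inc_word assms c p by auto
    qed (use x p Add in \<open>auto simp: rmul_Add\<close>)
  next
    case (Sub j)
    show ?thesis
    proof (cases "count_list x (Ctr j) = 0")
      case True
      then show ?thesis using x p Sub
        by (cases P rule: conts.cases) (auto simp: rmul_Sub_zero)
    next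
      case False
      then obtain x' where "rmul out (x @ [St P]) (Run (Sub j)) = x' @ rmul out [St P] (Run (Subbed j))"
        using rmul_Sub[OF x(2)] by blast
      moreover have "s j \<noteq> 0" using False x by auto
      ultimately show ?thesis
      proof (cases rule: arrive_cases[of P "Subbed j"])
        case 1
        then show ?thesis using x p Sub \<open>rmul out (x @ [St P]) (Run (Sub j)) = _\<close> by auto
      next
        case (3 i B Q)
        then show ?thesis using Loop_word_Suc[of z j B Q s] assms c p Sub \<open>s j \<noteq> 0\<close> by auto
      qed auto
    qed
  next
    case (Subbed j)
    then show ?thesis using x p by auto
  next
    case (Zero_test j)
    show ?thesis
    proof (cases "count_list x (Ctr j) = 0")
      case True
      then show ?thesis
      proof (cases rule: arrive_cases[of P p])
        case 4
        then show ?thesis using Loop_word_zero[of z j _ _ s] assms c p x True Zero_test by auto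
      qed (use x p Zero_test True in \<open>auto simp: rmul_Zero_test\<close>)
    next
      case False
      then show ?thesis using x p Zero_test rmul_Zero_test_stuck[OF x(2)] by auto
    qed
  next
    case Halt
    then show ?thesis using x p c
      by (cases P rule: conts.cases) (auto simp: rmul_Halt)
  qed
qed

lemma halts_if_erased:
  assumes "cfg z c" "foldl (rmul out) z w = []"
  shows "halts c"
proof (rule ccontr)
  assume nh: "\<not> halts c"
  \<comment> \<open>The invariant: some token is stuck for ever, or a configuration that does not
    halt survives below letters \<open>g\<close>. The empty word satisfies neither.\<close>
  define ok where "ok z \<longleftrightarrow> stuck z \<or> (\<exists>g z' c'. z = g @ z' \<and> cfg z' c' \<and> \<not> halts c')" for z
  have "ok (rmul out z y)" if "ok z" for z y
  proof (cases "stuck z")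
    case True
    then show ?thesis by (simp add: ok_def stuck_rmul)
  next
    case False
    with that have "\<exists>g z' c'. z = g @ z' \<and> cfg z' c' \<and> \<not> halts c'"
      by (simp only: ok_def simp_thms)
    then obtain g z' c' where g: "z = g @ z'" "cfg z' c'" "\<not> halts c'"
      by (elim exE conjE)
    show ?thesis
    proof (cases g)
      case Nil
      have "fst c' \<noteq> []" using g(3) by (cases c') auto
      then consider "stuck (rmul out z' y)" | "cfg (rmul out z' y) (nxt c')" | "rmul out z' y = [y] @ z'"
        using rmul_cfg[OF g(2), of y] by auto
      then show ?thesis
      proof cases
        case 1
        then show ?thesis using g(1) Nil by (simp add: ok_def)
      next
        case 2
        moreover have "\<not> halts (nxt c')" using g(3) halts_nxt by simp
        ultimately show ?thesis unfolding ok_def g(1) Nil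
          by (intro disjI2 exI[of _ "[]"] exI[of _ "rmul out z' y"] exI[of _ "nxt c'"]) simp
      next
        case 3
        then show ?thesis unfolding ok_def g(1) Nil using g(2,3)
          by (intro disjI2 exI[of _ "[y]"] exI[of _ z'] exI[of _ c']) simp
      qed
    next
      case (Cons a g')
      obtain h where "rmul out z y = h @ z'"
        using rmul_append_cfg[OF g(2), of a g' y] g(1) Cons by auto
      then show ?thesis unfolding ok_def using g(2,3) by blast
    qed
  qed
  then have "ok (foldl (rmul out) z w)" if "ok z" for z
    using that by (induction w arbitrary: z) auto
  moreover have "ok z" unfolding ok_def using assms(1) nh
    by (intro disjI2 exI[of _ "[]"] exI[of _ z] exI[of _ c]) simp
  ultimately have "ok []" using assms(2) by fastforce
  then show False by (auto simp: ok_def stuck_def cfg_def)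
qed

definition input :: "instr list \<Rightarrow> nat \<Rightarrow> letter list" where
  "input P n = St P # replicate n (Ctr 0) @ [End]"

lemma input_lists: "input P n \<in> lists (letters P)"
  by (auto simp: input_def letters_def self_conts)

lemma inactive_input: "\<forall>y\<in>set (input P n). \<not> active y"
  by (auto simp: input_def)

lemma erasable_input_iff:
  "(\<exists>v\<in>lists (letters P). foldl (rmul out) [] (input P n @ v) = []) \<longleftrightarrow>
     halts (P, (\<lambda>_. 0)(0 := n))"
proof -
  have "foldl (rmul out) [] (input P n) = rev (input P n)"
    using inactive_input inert_if_inactive by (subst foldl_rmul_inert) auto
  then have *: "foldl (rmul out) [] (input P n @ v) = foldl (rmul out) (rev (input P n)) v" for v
    by simp
  have "count_list (replicate n (Ctr 0)) (Ctr j) = ((\<lambda>_. 0)(0 := n)) j" for j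
    by (induction n) auto
  then have "cfg (rev (input P n)) (P, (\<lambda>_. 0)(0 := n))"
    unfolding cfg_def input_def by (intro exI[of _ "replicate n (Ctr 0)"]) (auto simp: mobile_def)
  then show ?thesis unfolding * using erase_if_halts halts_if_erased self_conts by fastforce
qed

section \<open>Coding the letters by natural numbers\<close>

definition out_nat :: "nat \<Rightarrow> nat \<Rightarrow> nat outcome" where
  "out_nat x y = map_outcome to_nat (out (from_nat x) (from_nat y))"

lemma rmul_nat: "rmul out_nat (map to_nat z) (to_nat y) = map to_nat (rmul out z y)"
  by (induction z arbitrary: y) (auto simp: out_nat_def split: outcome.splits)

lemma foldl_rmul_nat:
  "foldl (rmul out_nat) (map to_nat z) (map to_nat w) = map to_nat (foldl (rmul out) z w)"
  by (induction w arbitrary: z) (auto simp: rmul_nat)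

text \<open>The locale conditions reduce to the division into active and inactive letters: active
  ones never stand on the left of a redex, inactive ones never on the right. Moves yield
  \<open>Run\<close> tokens, whereas the only deleted token is \<open>Eraser\<close>.\<close>

lemma nat_sliding_out: "nat_sliding (to_nat ` letters P) out_nat"
proof
  show "finite (to_nat ` letters P)" by (simp add: finite_letters)
  show "set (rhs (out_nat x y)) \<subseteq> to_nat ` letters P"
    if "x \<in> to_nat ` letters P" "y \<in> to_nat ` letters P" for x y
  proof -
    have "rhs (map_outcome f r) = map f (rhs r)" for f :: "letter \<Rightarrow> nat" and r by (cases r) auto
    then show ?thesis using that out_letters by (fastforce simp: out_nat_def)
  qed
next
  fix x y assume "out_nat x y \<noteq> Stuck"
  then have "\<not> active (from_nat x)" using active_left by (auto simp: out_nat_def)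
  then show "inert out_nat x" using inert_if_inactive by (auto simp: out_nat_def)
next
  fix x y t m assume "out_nat x y = Move t m"
  then obtain t' m' where "out (from_nat x) (from_nat y) = Move t' m'" "m = to_nat m'"
    by (cases "out (from_nat x) (from_nat y)") (auto simp: out_nat_def)
  then show "inert out_nat m" using out_Move inert_if_inactive by (fastforce simp: out_nat_def)
next
  fix x y a b assume "out_nat x y = Put a b"
  then obtain a' b' where "out (from_nat x) (from_nat y) = Put a' b'" "a = to_nat a'" "b = to_nat b'"
    by (cases "out (from_nat x) (from_nat y)") (auto simp: out_nat_def)
  then show "inert out_nat a \<and> inert out_nat b"
    using out_Put arrive_Put inert_if_inactive by (fastforce simp: out_nat_def)
next
  fix x s z t m assume *: "out_nat x s = Del"
  have "from_nat s = Eraser" using * out_Del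
    by (cases "out (from_nat x) (from_nat s)") (auto simp: out_nat_def)
  then show "out_nat z t \<noteq> Move s m"
    using out_Move by (cases "out (from_nat z) (from_nat t)") (fastforce simp: out_nat_def)+
qed

definition input_nat :: "instr list \<Rightarrow> nat \<Rightarrow> nat list" where
  "input_nat P n = map to_nat (input P n)"

context
  fixes P :: "instr list"
begin

interpretation nat_sliding "to_nat ` letters P" out_nat
  by (rule nat_sliding_out)

text \<open>Right invertible means erasable, and an input word can be erased iff the program halts
  on it. Input words have only inactive letters, so they are their own normal forms.\<close>

theorem program_monoid:
  "\<exists>(S :: nat monoid) (A :: nat set) L Leq La sigma.
     monoid S \<and> finitely_presented S \<and> automatic_structure S A L Leq La sigma \<and>
     (\<forall>n. input_nat P n \<in> L \<and>
        (has_right_inverse S (sigma (input_nat P n)) \<longleftrightarrow> halts (P, (\<lambda>_. 0)(0 := n))))"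
proof -
  have 1: "input_nat P n \<in> lists (to_nat ` letters P)" for n
    using input_lists[of P n] by (auto simp: input_nat_def)
  have 2: "nf (map to_nat w) = map to_nat (rev (foldl (rmul out) [] w))" for w :: "letter list"
    using foldl_rmul_nat[of "[]" w] by (simp add: nf_def rev_map)
  have "foldl (rmul out) [] (input P n) = rev (input P n)" for n
    using inactive_input inert_if_inactive by (subst foldl_rmul_inert) auto
  then have "nf (input_nat P n) = input_nat P n" for n
    unfolding input_nat_def 2 by simp
  then have 3: "input_nat P n \<in> reps" for n using nf_in_reps[OF 1, of n] by simp
  have "has_right_inverse S (sigma (input_nat P n)) \<longleftrightarrow> halts (P, (\<lambda>_. 0)(0 := n))" for n
  proof -
    have "has_right_inverse S (sigma (input_nat P n)) \<longleftrightarrow>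
        (\<exists>v\<in>map to_nat ` lists (letters P). nf (input_nat P n @ v) = [])"
      unfolding has_right_inverse_sigma[OF 1] by (simp add: lists_image)
    also have "\<dots> \<longleftrightarrow> (\<exists>v\<in>lists (letters P). foldl (rmul out) [] (input P n @ v) = [])"
      unfolding input_nat_def bex_simps map_append[symmetric] 2 by simp
    finally show ?thesis unfolding erasable_input_iff .
  qed
  then show ?thesis using monoid_S finitely_presented_S automatic_S 3 by blast
qed

end

section \<open>Compiling recursive functions to counter programs\<close>

inductive run :: "instr list \<Rightarrow> (nat \<Rightarrow> nat) \<Rightarrow> (nat \<Rightarrow> nat) \<Rightarrow> bool" where
  Nil: "run [] s s"
| Inc: "run P (s(j := Suc (s j))) t \<Longrightarrow> run (Inc j # P) s t"
| Loop0: "s j = 0 \<Longrightarrow> run P s t \<Longrightarrow> run (Loop j B # P) s t"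
| LoopS: "s j = Suc n \<Longrightarrow> run B (s(j := n)) s' \<Longrightarrow> run (Loop j B # P) s' t \<Longrightarrow> run (Loop j B # P) s t"

lemma run_append: "run P s t \<Longrightarrow> run Q t r \<Longrightarrow> run (P @ Q) s r"
  by (induction rule: run.induct) (auto intro: run.intros)

text \<open>The machine is deterministic, so a terminating first part can be skipped. The arbitrary
  continuation \<open>Q\<close> makes the induction work, and the equivalence also transfers
  non-termination of \<open>Q\<close>.\<close>

lemma halts_run: "run P s t \<Longrightarrow> halts (P @ Q, s) \<longleftrightarrow> halts (Q, t)"
proof (induction arbitrary: Q rule: run.induct)
  case (Inc P s j t)
  have "halts (Inc j # P @ Q, s) = halts (P @ Q, s(j := Suc (s j)))"
    unfolding halts_nxt[of "(Inc j # P @ Q, s)", symmetric] nxt.simps ..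
  then show ?case unfolding Inc.IH by simp
next
  case (Loop0 s j P t B)
  then show ?case using halts_nxt[of "(Loop j B # P @ Q, s)"] by simp
next
  case (LoopS s j n B s' P t)
  have "halts (Loop j B # P @ Q, s) = halts (B @ Loop j B # P @ Q, s(j := n))"
    unfolding halts_nxt[of "(Loop j B # P @ Q, s)", symmetric] nxt.simps using LoopS by simp
  then show ?case unfolding LoopS.IH(1) using LoopS.IH(2) by simp
qed simp

text \<open>\<open>f i\<close> is the store after \<open>i\<close> rounds. The machine decrements
  the counter before it enters the body, hence the start value \<open>n - Suc i\<close> there. The
  induction is on the number of rounds still to come.\<close>

lemma run_Loop:
  assumes "s j = n"
    and "\<And>i. i < n \<Longrightarrow> run B ((f i)(j := n - Suc i)) (f (Suc i))"
    and "f 0 = s" "\<And>i. i \<le> n \<Longrightarrow> f i j = n - i"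
  shows "run [Loop j B] s (f n)"
proof -
  have "run [Loop j B] (f (n - k)) (f n)" if "k \<le> n" for k
    using that
  proof (induction k)
    case 0
    then show ?case using assms(4)[of n] by (auto intro: run.intros)
  next
    case (Suc k)
    have "f (n - Suc k) j = Suc k" using assms(4)[of "n - Suc k"] Suc.prems by simp
    moreover have "run B ((f (n - Suc k))(j := k)) (f (n - k))"
      using assms(2)[of "n - Suc k"] Suc.prems by (simp add: Suc_diff_Suc)
    ultimately show ?case using Suc by (auto intro: run.LoopS)
  qed
  from this[of n] show ?thesis using assms(3) by simp
qed

lemma run_clear: "run [Loop j []] s (s(j := 0))"
  using run_Loop[of s j "s j" "[]" "\<lambda>i. s(j := s j - i)"] by (auto intro: run.Nil)

lemma run_single_Inc: "run [Inc j] s (s(j := Suc (s j)))"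
  by (intro run.Inc run.Nil)

lemma run_transfer:
  assumes "a \<noteq> b"
  shows "run [Loop a [Inc b]] s (s(a := 0, b := s b + s a))"
proof -
  define f where "f i = s(a := s a - i, b := s b + i)" for i
  have "run [Inc b] ((f i)(a := s a - Suc i)) (f (Suc i))" for i
  proof -
    have eq: "f (Suc i) = ((f i)(a := s a - Suc i))(b := Suc (((f i)(a := s a - Suc i)) b))"
      using assms by (auto simp: f_def fun_eq_iff)
    show ?thesis unfolding eq by (rule run_single_Inc)
  qed
  note step = this
  have "run [Loop a [Inc b]] s (f (s a))"
    by (rule run_Loop[where f = f, OF _ step]) (use assms in \<open>simp_all add: f_def\<close>)
  then show ?thesis by (simp add: f_def)
qed

text \<open>A loop consumes its counter, so a second copy is kept in the scratch register
  \<open>t\<close> and then moved back to \<open>a\<close>.\<close>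

definition copy :: "nat \<Rightarrow> nat \<Rightarrow> nat \<Rightarrow> instr list" where
  "copy a b t = [Loop a [Inc b, Inc t], Loop t [Inc a]]"

lemma run_copy:
  assumes "a \<noteq> b" "a \<noteq> t" "b \<noteq> t" "s t = 0" "s b = 0"
  shows "run (copy a b t) s (s(b := s a))"
proof -
  define f where "f i = s(a := s a - i, b := i, t := i)" for i
  have "run [Inc b, Inc t] ((f i)(a := s a - Suc i)) (f (Suc i))" for i
  proof -
    have "f (Suc i) = (let s' = (f i)(a := s a - Suc i); s'' = s'(b := Suc (s' b)) in s''(t := Suc (s'' t)))"
      using assms by (auto simp: f_def fun_eq_iff)
    then show ?thesis by (auto simp: Let_def intro!: run.Inc run.Nil)
  qed
  note step = this
  have "f 0 = s" using assms by (auto simp: f_def fun_eq_iff)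
  then have "run [Loop a [Inc b, Inc t]] s (f (s a))"
    by (intro run_Loop[where f = f, OF _ step]) (use assms in \<open>simp_all add: f_def\<close>)
  moreover have "run [Loop t [Inc a]] (f (s a)) (s(b := s a))"
  proof -
    have "(f (s a))(t := 0, a := f (s a) a + f (s a) t) = s(b := s a)"
      using assms by (auto simp: f_def fun_eq_iff)
    then show ?thesis using run_transfer[of t a "f (s a)"] assms by simp
  qed
  ultimately show ?thesis using run_append unfolding copy_def by fastforce
qed

text \<open>Arguments in the registers \<open>xs\<close>, result in register \<open>r\<close>; the registers from \<open>m\<close> on are scratch and are left at \<open>0\<close>.\<close>

fun compile :: "recf \<Rightarrow> nat list \<Rightarrow> nat \<Rightarrow> nat \<Rightarrow> instr list"
  and compile_list :: "recf list \<Rightarrow> nat list \<Rightarrow> nat \<Rightarrow> nat \<Rightarrow> instr list"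
where
  "compile Zero xs r m = []"
| "compile Succ xs r m = copy (hd xs) r m @ [Inc r]"
| "compile (Proj i) xs r m = copy (xs ! i) r m"
| "compile (Comp f gs) xs r m =
     compile_list gs xs m (m + length gs) @ compile f [m..<m + length gs] r (m + length gs)
       @ map (\<lambda>j. Loop j []) [m..<m + length gs]"
| "compile (PrimRec f g) xs r m =
     copy (hd xs) m r @ compile f (tl xs) (m + 2) (m + 4)
       @ [Loop m (compile g ((m + 1) # (m + 2) # tl xs) (m + 3) (m + 4)
            @ [Loop (m + 2) [], Loop (m + 3) [Inc (m + 2)], Inc (m + 1)]),
          Loop (m + 1) [], Loop (m + 2) [Inc r]]"
| "compile (Mini f) xs r m =
     compile f (r # xs) m (m + 1)
       @ [Loop m ([Loop m [], Inc r] @ compile f (r # xs) m (m + 1))]"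
| "compile_list [] xs r m = []"
| "compile_list (g # gs) xs r m = compile g xs r m @ compile_list gs xs (Suc r) m"

text \<open>The final store differs from \<open>s\<close> at most in \<open>r\<close>: arguments
  survive and scratch registers are zero again, so that calls can be nested.\<close>

definition computes :: "instr list \<Rightarrow> nat list \<Rightarrow> nat \<Rightarrow> nat \<Rightarrow> nat list \<Rightarrow> nat \<Rightarrow> bool" where
  "computes P xs r m vs y \<longleftrightarrow>
     (\<forall>s. map s xs = vs \<longrightarrow> s r = 0 \<longrightarrow> r \<notin> set xs \<longrightarrow> r < m \<longrightarrow> (\<forall>x\<in>set xs. x < m)
        \<longrightarrow> (\<forall>j\<ge>m. s j = 0) \<longrightarrow> run P s (s(r := y)))"


lemma computesD:
  assumes "computes P xs r m vs y" "map s xs = vs" "s r = 0" "r \<notin> set xs" "r < m" "\<forall>x\<in>set xs. x < m"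
    "\<forall>j\<ge>m. s j = 0" "t = s(r := y)"
  shows "run P s t"
  using assms unfolding computes_def by blast

inductive_cases reval_Zero: "reval Zero vs y"
inductive_cases reval_Succ: "reval Succ vs y"
inductive_cases reval_Proj: "reval (Proj i) vs y"
inductive_cases reval_Comp: "reval (Comp f gs) vs y"
inductive_cases reval_PrimRec: "reval (PrimRec f g) vs y"
inductive_cases reval_PrimRec_Suc: "reval (PrimRec f g) (Suc n # vs) y"
inductive_cases reval_PrimRec_0: "reval (PrimRec f g) (0 # vs) y"
inductive_cases reval_Mini: "reval (Mini f) vs y"

text \<open>The sequence \<open>v\<close> of intermediate values yields an explicit store for each
  round, as \<open>run_Loop\<close> requires.\<close>

lemma reval_PrimRec_seq:
  "reval (PrimRec f g) (n # vs) y \<Longrightarrow>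
     \<exists>v. reval f vs (v 0) \<and> (\<forall>i<n. reval g (i # v i # vs) (v (Suc i))) \<and> y = v n"
proof (induction n arbitrary: y)
  case 0
  then show ?case by (intro exI[of _ "\<lambda>_. y"]) (auto elim: reval_PrimRec_0)
next
  case (Suc n)
  from Suc.prems obtain y' where "reval (PrimRec f g) (n # vs) y'" "reval g (n # y' # vs) y"
    by (rule reval_PrimRec_Suc)
  then obtain v where "reval f vs (v 0)" "\<forall>i<n. reval g (i # v i # vs) (v (Suc i))" "y' = v n"
    using Suc.IH by blast
  then show ?case using \<open>reval g (n # y' # vs) y\<close>
    by (intro exI[of _ "v(Suc n := y)"]) (auto simp: less_Suc_eq)
qed

definition upd :: "(nat \<Rightarrow> nat) \<Rightarrow> nat \<Rightarrow> nat list \<Rightarrow> nat \<Rightarrow> nat" where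
  "upd s r ys j = (if r \<le> j \<and> j < r + length ys then ys ! (j - r) else s j)"

lemma upd_Cons: "upd s r (y # ys) = upd (s(r := y)) (Suc r) ys"
  by (auto simp: upd_def fun_eq_iff nth_Cons' Suc_diff_le)

lemma run_clears: "run (map (\<lambda>j. Loop j []) js) s (\<lambda>j. if j \<in> set js then 0 else s j)"
proof (induction js arbitrary: s)
  case Nil
  then show ?case by (simp add: run.Nil)
next
  case (Cons a js)
  have "(\<lambda>j. if j \<in> set js then 0 else (s(a := 0)) j) = (\<lambda>j. if j \<in> set (a # js) then 0 else s j)"
    by auto
  then show ?case using run_append[OF run_clear[of a s] Cons[of "s(a := 0)"]] by simp
qed

lemma run_compile_list:
  assumes "\<And>g y xs r m. g \<in> set gs \<Longrightarrow> reval g vs y \<Longrightarrow> computes (compile g xs r m) xs r m vs y"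
    and "list_all2 (\<lambda>g y. reval g vs y) gs ys"
    and "map s xs = vs" "\<forall>x\<in>set xs. x < r" "\<forall>j\<ge>r. s j = 0" "r + length gs \<le> m"
  shows "run (compile_list gs xs r m) s (upd s r ys)"
  using assms
proof (induction gs arbitrary: ys s r)
  case Nil
  then have "upd s r ys = s" by (auto simp: upd_def fun_eq_iff)
  then show ?case by (simp add: run.Nil)
next
  case (Cons g gs)
  then obtain y ys' where ys: "ys = y # ys'" "reval g vs y" "list_all2 (\<lambda>g y. reval g vs y) gs ys'"
    by (auto simp: list_all2_Cons1)
  have "computes (compile g xs r m) xs r m vs y" using Cons.prems(1)[of g] ys(2) by simp
  then have "run (compile g xs r m) s (s(r := y))"
    by (rule computesD) (use Cons.prems in \<open>auto\<close>)
  moreover have "run (compile_list gs xs (Suc r) m) (s(r := y)) (upd (s(r := y)) (Suc r) ys')"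
    using Cons.prems ys by (intro Cons.IH) (auto simp: less_Suc_eq)
  ultimately show ?case unfolding ys upd_Cons by (simp add: run_append)
qed

lemma compile_computes: "reval f vs y \<Longrightarrow> computes (compile f xs r m) xs r m vs y"
proof (induction f arbitrary: vs y xs r m)
  case Zero
  then have "y = 0" by (auto elim: reval_Zero)
  have "s(r := 0) = s" if "s r = 0" for s :: "nat \<Rightarrow> nat" using that by auto
  then show ?case using run.Nil \<open>y = 0\<close> by (auto simp: computes_def)
next
  case Succ
  then obtain v vs' where v: "vs = v # vs'" "y = Suc v" by (auto elim: reval_Succ)
  show ?case unfolding computes_def
  proof (intro allI impI)
    fix s :: "nat \<Rightarrow> nat"
    assume s: "map s xs = vs" "s r = 0" "r \<notin> set xs" "r < m" "\<forall>x\<in>set xs. x < m" "\<forall>j\<ge>m. s j = 0"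
    then obtain x xs' where xs: "xs = x # xs'" "s x = v" using v by auto
    then have "run (copy x r m) s (s(r := s x))" using s by (intro run_copy) auto
    then show "run (compile Succ xs r m) s (s(r := y))"
      using run_append[OF _ run_single_Inc[of r "s(r := s x)"]] xs v by simp
  qed
next
  case (Proj i)
  then have v: "i < length vs" "y = vs ! i" by (auto elim: reval_Proj)
  show ?case unfolding computes_def
  proof (intro allI impI)
    fix s :: "nat \<Rightarrow> nat"
    assume s: "map s xs = vs" "s r = 0" "r \<notin> set xs" "r < m" "\<forall>x\<in>set xs. x < m" "\<forall>j\<ge>m. s j = 0"
    then have i: "i < length xs" "y = s (xs ! i)" "xs ! i \<in> set xs" using v by auto
    have "run (copy (xs ! i) r m) s (s(r := s (xs ! i)))"
      using s i by (intro run_copy) (auto simp: less_imp_neq)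
    then show "run (compile (Proj i) xs r m) s (s(r := y))" using i by simp
  qed
next
  case (Comp f gs)
  then obtain ys where ys: "list_all2 (\<lambda>g y. reval g vs y) gs ys" "reval f ys y" by (auto elim: reval_Comp)
  then have len: "length ys = length gs" by (simp add: list_all2_lengthD)
  show ?case unfolding computes_def
  proof (intro allI impI)
    fix s :: "nat \<Rightarrow> nat"
    assume s: "map s xs = vs" "s r = 0" "r \<notin> set xs" "r < m" "\<forall>x\<in>set xs. x < m" "\<forall>j\<ge>m. s j = 0"
    define M where "M = m + length gs"
    define u where "u = upd s m ys"
    have 1: "run (compile_list gs xs m M) s u"
      unfolding u_def M_def using Comp.IH(2) ys(1) s by (intro run_compile_list) auto
    have 2: "run (compile f [m..<M] r M) u (u(r := y))"
    proof (rule computesD[OF Comp.IH(1)[OF ys(2)]])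
      show "map u [m..<M] = ys"
        by (rule nth_equalityI) (auto simp: u_def upd_def M_def len)
    qed (use s in \<open>auto simp: u_def upd_def M_def len\<close>)
    have "(\<lambda>j. if j \<in> set [m..<M] then 0 else (u(r := y)) j) = s(r := y)"
      using s by (auto simp: fun_eq_iff u_def upd_def M_def len)
    then have 3: "run (map (\<lambda>j. Loop j []) [m..<M]) (u(r := y)) (s(r := y))"
      using run_clears[of "[m..<M]" "u(r := y)"] by simp
    show "run (compile (Comp f gs) xs r m) s (s(r := y))"
      using run_append[OF 1 run_append[OF 2 3]] by (simp add: M_def)
  qed
next
  case (PrimRec f g)
  then obtain n vs' where vs: "vs = n # vs'" by (auto elim: reval_PrimRec)
  then obtain v where v: "reval f vs' (v 0)" "\<And>i. i < n \<Longrightarrow> reval g (i # v i # vs') (v (Suc i))" "y = v n"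
    using reval_PrimRec_seq PrimRec.prems by blast
  show ?case unfolding computes_def
  proof (intro allI impI)
    fix s :: "nat \<Rightarrow> nat"
    assume s: "map s xs = vs" "s r = 0" "r \<notin> set xs" "r < m" "\<forall>x\<in>set xs. x < m" "\<forall>j\<ge>m. s j = 0"
    then obtain a as where xs: "xs = a # as" "s a = n" "map s as = vs'" using vs by auto
    have le: "x < m" "x \<noteq> r" if "x \<in> set xs" for x using s that by auto
    \<comment> \<open>Register \<open>m\<close> counts the remaining rounds, \<open>m + 1\<close>
      holds the index and \<open>m + 2\<close> the current value; \<open>m + 3\<close> receives the
      next value during a round.\<close>
    define F where "F i = s(m := n - i, m + 1 := i, m + 2 := v i)" for i
    have map_as: "map t as = vs'" if "\<And>x. x < m \<Longrightarrow> t x = s x" for t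
      using xs that le by auto
    \<comment> \<open>The result register is still zero and serves as scratch register of the
      copy.\<close>
    have 1: "run (copy a m r) s (s(m := n))"
      using run_copy[of a m r s] s xs le by auto
    have 2: "run (compile f as (m + 2) (m + 4)) (s(m := n)) (F 0)"
    proof (rule computesD[OF PrimRec.IH(1)[OF v(1)]])
      show "map (s(m := n)) as = vs'" by (rule map_as) simp
      show "m + 2 \<notin> set as" "\<forall>x\<in>set as. x < m + 4" using le xs by fastforce+
    qed (use s in \<open>auto simp: F_def fun_eq_iff\<close>)
    let ?B = "compile g ((m + 1) # (m + 2) # as) (m + 3) (m + 4)
            @ [Loop (m + 2) [], Loop (m + 3) [Inc (m + 2)], Inc (m + 1)]"
    have step: "run ?B ((F i)(m := n - Suc i)) (F (Suc i))" if "i < n" for i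
    proof -
      define s0 where "s0 = (F i)(m := n - Suc i)"
      have c1: "run (compile g ((m + 1) # (m + 2) # as) (m + 3) (m + 4)) s0 (s0(m + 3 := v (Suc i)))"
      proof (rule computesD[OF PrimRec.IH(2)[OF v(2)[OF that]]])
        have "map s0 as = vs'" by (rule map_as) (simp add: s0_def F_def)
        then show "map s0 ((m + 1) # (m + 2) # as) = i # v i # vs'" by (simp add: s0_def F_def)
        show "m + 3 \<notin> set ((m + 1) # (m + 2) # as)" "\<forall>x\<in>set ((m + 1) # (m + 2) # as). x < m + 4"
          using le xs by fastforce+
      qed (use s in \<open>auto simp: s0_def F_def\<close>)
      have c2: "run [Loop (m + 2) []] (s0(m + 3 := v (Suc i))) (s0(m + 3 := v (Suc i), m + 2 := 0))"
        by (rule run_clear)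
      have c3: "run [Loop (m + 3) [Inc (m + 2)]] (s0(m + 3 := v (Suc i), m + 2 := 0))
          (s0(m + 3 := 0, m + 2 := v (Suc i)))"
        using run_transfer[of "m + 3" "m + 2" "s0(m + 3 := v (Suc i), m + 2 := 0)"]
        by (simp add: fun_upd_twist[of "m + 2" "m + 3"])
      have c4: "run [Inc (m + 1)] (s0(m + 3 := 0, m + 2 := v (Suc i))) (F (Suc i))"
      proof -
        have "F (Suc i) = (s0(m + 3 := 0, m + 2 := v (Suc i)))(m + 1 := Suc (s0 (m + 1)))"
          using s by (auto simp: s0_def F_def fun_eq_iff)
        then show ?thesis using run_single_Inc[of "m + 1" "s0(m + 3 := 0, m + 2 := v (Suc i))"] by simp
      qed
      show ?thesis
        using run_append[OF c1 run_append[OF c2 run_append[OF c3 c4]]] by (simp add: s0_def)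
    qed
    have 3: "run [Loop m ?B] (F 0) (F n)"
      using step by (intro run_Loop[where f = F]) (auto simp: F_def)
    have 4: "run [Loop (m + 1) []] (F n) ((F n)(m + 1 := 0))" by (rule run_clear)
    have 5: "run [Loop (m + 2) [Inc r]] ((F n)(m + 1 := 0)) (s(r := y))"
    proof -
      have "((F n)(m + 1 := 0))(m + 2 := 0, r := ((F n)(m + 1 := 0)) r + ((F n)(m + 1 := 0)) (m + 2)) = s(r := y)"
        using s v(3) by (auto simp: F_def fun_eq_iff)
      then show ?thesis using run_transfer[of "m + 2" r "(F n)(m + 1 := 0)"] s by simp
    qed
    show "run (compile (PrimRec f g) xs r m) s (s(r := y))"
      using run_append[OF 1 run_append[OF 2 run_append[OF 3 run_append[OF 4 5]]]] xs by simp
  qed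
next
  case (Mini f)
  from Mini.prems have y: "reval f (y # vs) 0" "\<forall>i<y. \<exists>k. reval f (i # vs) (Suc k)"
    by (auto elim: reval_Mini)
  then obtain k where k: "\<And>i. i < y \<Longrightarrow> reval f (i # vs) (Suc (k i))" by metis
  \<comment> \<open>The values of the searched function at \<open>i\<close> up to \<open>y\<close>;
    the loop ends at the only zero among them, \<open>T y\<close>.\<close>
  define T where "T i = (if i < y then Suc (k i) else 0)" for i
  have T: "reval f (i # vs) (T i)" if "i \<le> y" for i
    using y(1) k that by (cases "i = y") (auto simp: T_def)
  show ?case unfolding computes_def
  proof (intro allI impI)
    fix s :: "nat \<Rightarrow> nat"
    assume s: "map s xs = vs" "s r = 0" "r \<notin> set xs" "r < m" "\<forall>x\<in>set xs. x < m" "\<forall>j\<ge>m. s j = 0"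
    let ?C = "compile f (r # xs) m (m + 1)"
    let ?B = "[Loop m [], Inc r] @ ?C"
    have comp: "run ?C (s(r := i)) (s(r := i, m := T i))" if "i \<le> y" for i
    proof (rule computesD[OF Mini.IH[OF T[OF that]]])
      show "map (s(r := i)) (r # xs) = i # vs" using s by auto
    qed (use s in \<open>auto simp: less_Suc_eq\<close>)
    \<comment> \<open>The body overwrites its own loop counter \<open>m\<close>, so
      \<open>run_Loop\<close> does not fit; instead there is an induction on the distance
      \<open>j\<close> of the candidate in \<open>r\<close> from \<open>y\<close>.\<close>
    have "run [Loop m ?B] (s(r := y - j, m := T (y - j))) (s(r := y))" if "j \<le> y" for j
      using that
    proof (induction j)
      case 0
      have eq: "s(r := y, m := 0) = s(r := y)" using s by (auto simp: fun_eq_iff)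
      have "run [Loop m ?B] (s(r := y, m := 0)) (s(r := y))"
        unfolding eq by (intro run.Loop0 run.Nil) (use s in auto)
      moreover have "T y = 0" by (simp add: T_def)
      ultimately show ?case by (simp only: diff_zero)
    next
      case (Suc j)
      define i where "i = y - Suc j"
      have i: "i < y" "y - j = Suc i" using Suc.prems by (auto simp: i_def)
      have c1: "run [Loop m []] ((s(r := i, m := T i))(m := k i)) (s(r := i))"
      proof -
        have "((s(r := i, m := T i))(m := k i))(m := 0) = s(r := i)" using s by (auto simp: fun_eq_iff)
        then show ?thesis using run_clear[of m "(s(r := i, m := T i))(m := k i)"] by simp
      qed
      have c2: "run [Inc r] (s(r := i)) (s(r := Suc i))"
        using run_single_Inc[of r "s(r := i)"] by simp
      have c3: "run ?C (s(r := Suc i)) (s(r := Suc i, m := T (Suc i)))"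
        using comp i by simp
      have b: "run ?B ((s(r := i, m := T i))(m := k i)) (s(r := Suc i, m := T (Suc i)))"
        using run_append[OF c1 run_append[OF c2 c3]] by simp
      have v: "(s(r := i, m := T i)) m = Suc (k i)" using i by (simp add: T_def)
      have l: "run [Loop m ?B] (s(r := Suc i, m := T (Suc i))) (s(r := y))"
        using Suc.IH[OF Suc_leD[OF Suc.prems]] unfolding i(2) .
      show ?case unfolding i_def[symmetric] by (rule run.LoopS[OF v b l])
    qed
    note loop = this
    from run_append[OF comp[OF le0] loop[OF le_refl, unfolded diff_self_eq_0]]
    have "run (compile (Mini f) xs r m) (s(r := 0)) (s(r := y))" by (simp only: compile.simps)
    moreover have "s(r := 0) = s" using s by auto
    ultimately show "run (compile (Mini f) xs r m) s (s(r := y))" by simp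
  qed
qed

text \<open>From a positive \<open>r\<close> the machine alternates for ever between two
  configurations, decrementing and incrementing \<open>r\<close>.\<close>

lemma halts_zero_test: "halts ([Loop r [Inc r]], s) \<longleftrightarrow> s r = 0"
proof
  assume "halts ([Loop r [Inc r]], s)"
  then obtain n where n: "fst ((nxt ^^ n) ([Loop r [Inc r]], s)) = []" unfolding halts_def by blast
  show "s r = 0"
  proof (rule ccontr)
    assume "s r \<noteq> 0"
    then have "(nxt ^^ k) ([Loop r [Inc r]], s) \<in>
       {([Loop r [Inc r]], s), ([Inc r, Loop r [Inc r]], s(r := s r - 1))}" for k
      by (induction k) auto
    then show False using n by (metis fst_conv insertE list.distinct(1) singletonD)
  qed
next
  assume "s r = 0"
  then show "halts ([Loop r [Inc r]], s)"
    using halts_nxt[of "([Loop r [Inc r]], s)"] by simp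
qed

lemma halts_compile:
  assumes "reval f [n] y"
  shows "halts (compile f [0] 1 2 @ [Loop 1 [Inc 1]], (\<lambda>_. 0)(0 := n)) \<longleftrightarrow> y = 0"
proof -
  have "run (compile f [0] 1 2) ((\<lambda>_. 0)(0 := n)) ((\<lambda>_. 0)(0 := n, 1 := y))"
    by (rule computesD[OF compile_computes[OF assms]]) auto
  then show ?thesis using halts_run halts_zero_test by simp
qed

section \<open>A universal recursive function\<close>

text \<open>Total functions of fixed arity; closure properties of this predicate replace explicit
  terms of type \<open>recf\<close>.\<close>

definition rec_fun :: "nat \<Rightarrow> (nat list \<Rightarrow> nat) \<Rightarrow> bool" where
  "rec_fun k F \<longleftrightarrow> (\<exists>f. \<forall>xs. length xs = k \<longrightarrow> reval f xs (F xs))"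

lemma rec_fun_cong: "rec_fun k F \<Longrightarrow> (\<And>xs. length xs = k \<Longrightarrow> F xs = G xs) \<Longrightarrow> rec_fun k G"
  unfolding rec_fun_def by metis

lemma rec_fun_nth: "i < k \<Longrightarrow> rec_fun k (\<lambda>xs. xs ! i)"
  unfolding rec_fun_def by (intro exI[of _ "Proj i"]) (auto intro: reval.proj)

lemma rec_fun_comp:
  assumes "rec_fun (length Fs) G" "\<forall>F\<in>set Fs. rec_fun k F"
  shows "rec_fun k (\<lambda>xs. G (map (\<lambda>F. F xs) Fs))"
proof -
  obtain g where g: "\<And>ys. length ys = length Fs \<Longrightarrow> reval g ys (G ys)"
    using assms(1) unfolding rec_fun_def by blast
  have "\<exists>fs. \<forall>xs. length xs = k \<longrightarrow> list_all2 (\<lambda>f y. reval f xs y) fs (map (\<lambda>F. F xs) Fs)"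
    using assms(2)
  proof (induction Fs)
    case (Cons F Fs)
    then obtain fs f where "\<forall>xs. length xs = k \<longrightarrow> list_all2 (\<lambda>f y. reval f xs y) fs (map (\<lambda>F. F xs) Fs)"
      "\<forall>xs. length xs = k \<longrightarrow> reval f xs (F xs)"
      unfolding rec_fun_def by auto
    then show ?case by (intro exI[of _ "f # fs"]) auto
  qed auto
  then obtain fs where "\<And>xs. length xs = k \<Longrightarrow> list_all2 (\<lambda>f y. reval f xs y) fs (map (\<lambda>F. F xs) Fs)"
    by blast
  then show ?thesis unfolding rec_fun_def
    by (intro exI[of _ "Comp g fs"]) (auto intro!: reval.comp g)
qed

lemma rec_fun_Suc: "rec_fun k F \<Longrightarrow> rec_fun k (\<lambda>xs. Suc (F xs))"
proof -
  have "reval Succ xs (Suc (xs ! 0))" if "length xs = 1" for xs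
    using that by (cases xs) (auto intro: reval.succ)
  then have "rec_fun (length [F]) (\<lambda>xs. Suc (xs ! 0))" unfolding rec_fun_def by auto
  then show "rec_fun k F \<Longrightarrow> rec_fun k (\<lambda>xs. Suc (F xs))"
    using rec_fun_comp[of "[F]" "\<lambda>xs. Suc (xs ! 0)" k] by simp
qed

lemma rec_fun_const: "rec_fun k (\<lambda>xs. c)"
proof (induction c)
  case 0
  then show ?case unfolding rec_fun_def by (blast intro: reval.zero)
qed (rule rec_fun_Suc)

lemma rec_fun_rec_nat:
  assumes "rec_fun k N" "rec_fun k F" "rec_fun (Suc (Suc k)) G"
  shows "rec_fun k (\<lambda>xs. rec_nat (F xs) (\<lambda>n y. G (n # y # xs)) (N xs))"
proof -
  obtain f g where f: "\<And>xs. length xs = k \<Longrightarrow> reval f xs (F xs)"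
    and g: "\<And>xs. length xs = Suc (Suc k) \<Longrightarrow> reval g xs (G xs)"
    using assms unfolding rec_fun_def by blast
  define H where "H xs = rec_nat (F (tl xs)) (\<lambda>n y. G (n # y # tl xs)) (hd xs)" for xs
  \<comment> \<open>The recursion argument followed by all projections, which pass the parameters on
    unchanged.\<close>
  define Fs where "Fs = N # map (\<lambda>i xs. xs ! i) [0..<k]"
  have "reval (PrimRec f g) (n # xs) (H (n # xs))" if "length xs = k" for n xs
    using that by (induction n) (auto simp: H_def intro!: reval.pr0 reval.prS f g)
  then have "rec_fun (length Fs) H"
    unfolding rec_fun_def Fs_def by (intro exI[of _ "PrimRec f g"]) (auto simp: length_Suc_conv)
  then have "rec_fun k (\<lambda>xs. H (map (\<lambda>F. F xs) Fs))"
    by (rule rec_fun_comp) (auto simp: Fs_def assms(1) rec_fun_nth)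
  then show ?thesis
  proof (rule rec_fun_cong)
    fix xs :: "nat list" assume "length xs = k"
    then have "map (\<lambda>F. F xs) Fs = N xs # xs" by (auto simp: Fs_def comp_def intro: map_nth)
    then show "H (map (\<lambda>F. F xs) Fs) = rec_nat (F xs) (\<lambda>n y. G (n # y # xs)) (N xs)"
      by (simp add: H_def)
  qed
qed

lemma rec_fun_Least:
  assumes "rec_fun (Suc k) G" "\<And>xs. length xs = k \<Longrightarrow> \<exists>n. G (n # xs) = 0"
  shows "rec_fun k (\<lambda>xs. LEAST n. G (n # xs) = 0)"
proof -
  obtain g where g: "\<And>xs. length xs = Suc k \<Longrightarrow> reval g xs (G xs)"
    using assms(1) unfolding rec_fun_def by blast
  have "reval (Mini g) xs (LEAST n. G (n # xs) = 0)" if "length xs = k" for xs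
  proof (rule reval.mini)
    have "G ((LEAST n. G (n # xs) = 0) # xs) = 0" by (rule LeastI_ex) (use assms(2) that in blast)
    then show "reval g ((LEAST n. G (n # xs) = 0) # xs) 0"
      using g[of "(LEAST n. G (n # xs) = 0) # xs"] that by simp
    show "\<forall>m<LEAST n. G (n # xs) = 0. \<exists>y. reval g (m # xs) (Suc y)"
    proof (intro allI impI)
      fix m assume "m < (LEAST n. G (n # xs) = 0)"
      then have "G (m # xs) \<noteq> 0" by (rule not_less_Least)
      then show "\<exists>y. reval g (m # xs) (Suc y)"
        using g[of "m # xs"] that by (metis length_Cons not0_implies_Suc)
    qed
  qed
  then show ?thesis unfolding rec_fun_def by blast
qed

lemma rec_fun_app1: "rec_fun 1 (\<lambda>xs. G (xs ! 0)) \<Longrightarrow> rec_fun k F \<Longrightarrow> rec_fun k (\<lambda>xs. G (F xs))"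
  using rec_fun_comp[of "[F]" "\<lambda>xs. G (xs ! 0)" k] by simp

lemma rec_fun_app2:
  "rec_fun 2 (\<lambda>xs. G (xs ! 0) (xs ! 1)) \<Longrightarrow> rec_fun k E \<Longrightarrow> rec_fun k F \<Longrightarrow> rec_fun k (\<lambda>xs. G (E xs) (F xs))"
  using rec_fun_comp[of "[E, F]" "\<lambda>xs. G (xs ! 0) (xs ! 1)" k] by (simp add: numeral_2_eq_2)

lemma rec_fun_add: "rec_fun k E \<Longrightarrow> rec_fun k F \<Longrightarrow> rec_fun k (\<lambda>xs. E xs + F xs)"
proof (rule rec_fun_app2[where G = "(+)"])
  have "rec_fun 2 (\<lambda>xs. rec_nat (xs ! 1) (\<lambda>n y. Suc ((n # y # xs) ! 1)) (xs ! 0))"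
    by (intro rec_fun_rec_nat[where G = "\<lambda>xs. Suc (xs ! 1)"] rec_fun_Suc rec_fun_nth) auto
  moreover have "rec_nat b (\<lambda>n y. Suc ((n # y # xs) ! 1)) a = a + b" for a b and xs :: "nat list"
    by (induction a) auto
  ultimately show "rec_fun 2 (\<lambda>xs. xs ! 0 + xs ! 1)" by simp
qed

lemma rec_fun_pred: "rec_fun k F \<Longrightarrow> rec_fun k (\<lambda>xs. F xs - 1)"
proof (rule rec_fun_app1[where G = "\<lambda>x. x - 1"])
  have "rec_fun 1 (\<lambda>xs. rec_nat 0 (\<lambda>n y. (n # y # xs) ! 0) (xs ! 0))"
    by (intro rec_fun_rec_nat[where G = "\<lambda>xs. xs ! 0"] rec_fun_const rec_fun_nth) auto
  moreover have "rec_nat 0 (\<lambda>n y. (n # y # xs) ! 0) a = a - 1" for a and xs :: "nat list"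
    by (cases a) auto
  ultimately show "rec_fun 1 (\<lambda>xs. xs ! 0 - 1)" by simp
qed

lemma rec_fun_diff: "rec_fun k E \<Longrightarrow> rec_fun k F \<Longrightarrow> rec_fun k (\<lambda>xs. E xs - F xs)"
proof (rule rec_fun_app2[where G = "(-)"])
  have "rec_fun 2 (\<lambda>xs. rec_nat (xs ! 0) (\<lambda>n y. (n # y # xs) ! 1 - 1) (xs ! 1))"
    by (intro rec_fun_rec_nat[where G = "\<lambda>xs. xs ! 1 - 1"] rec_fun_pred rec_fun_nth) auto
  moreover have "rec_nat a (\<lambda>n y. (n # y # xs) ! 1 - 1) b = a - b" for a b and xs :: "nat list"
    by (induction b) auto
  ultimately show "rec_fun 2 (\<lambda>xs. xs ! 0 - xs ! 1)" by simp
qed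

lemma rec_fun_if_eq:
  assumes "rec_fun k C" "rec_fun k D" "rec_fun k E" "rec_fun k F"
  shows "rec_fun k (\<lambda>xs. if C xs = D xs then E xs else F xs)"
proof -
  \<comment> \<open>Case distinction by recursion: \<open>G [a, b, c]\<close> is \<open>b\<close> if
    \<open>a = 0\<close> and \<open>c\<close> otherwise. The sum of the two truncated differences
    below vanishes iff both sides are equal.\<close>
  define G :: "nat list \<Rightarrow> nat" where "G ys = rec_nat (ys ! 1) (\<lambda>n y. (n # y # ys) ! 4) (ys ! 0)" for ys
  have "rec_fun 3 G" unfolding G_def
    by (rule rec_fun_rec_nat[where G = "\<lambda>xs. xs ! 4"]) (auto intro: rec_fun_nth)
  moreover have "rec_fun k (\<lambda>xs. (C xs - D xs) + (D xs - C xs))"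
    using assms by (intro rec_fun_add rec_fun_diff)
  ultimately have "rec_fun k (\<lambda>xs. G (map (\<lambda>F. F xs) [\<lambda>xs. (C xs - D xs) + (D xs - C xs), E, F]))"
    using assms by (intro rec_fun_comp) (auto simp: numeral_3_eq_3)
  then show ?thesis
  proof (rule rec_fun_cong)
    fix xs :: "nat list"
    have "G [a, b, c] = (if a = 0 then b else c)" for a b c
      by (cases a) (auto simp: G_def)
    then show "G (map (\<lambda>F. F xs) [\<lambda>xs. (C xs - D xs) + (D xs - C xs), E, F]) =
        (if C xs = D xs then E xs else F xs)" by auto
  qed
qed

lemma rec_fun_triangle: "rec_fun k F \<Longrightarrow> rec_fun k (\<lambda>xs. triangle (F xs))"
proof (rule rec_fun_app1[where G = triangle])
  have "rec_fun 1 (\<lambda>xs. rec_nat 0 (\<lambda>n y. (n # y # xs) ! 1 + Suc ((n # y # xs) ! 0)) (xs ! 0))"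
    by (intro rec_fun_rec_nat[where G = "\<lambda>xs. xs ! 1 + Suc (xs ! 0)"] rec_fun_const rec_fun_add rec_fun_Suc
        rec_fun_nth) auto
  moreover have "rec_nat 0 (\<lambda>n y. (n # y # xs) ! 1 + Suc ((n # y # xs) ! 0)) a = triangle a"
    for a and xs :: "nat list"
    by (induction a) auto
  ultimately show "rec_fun 1 (\<lambda>xs. triangle (xs ! 0))" by simp
qed

lemma rec_fun_prod_encode:
  "rec_fun k E \<Longrightarrow> rec_fun k F \<Longrightarrow> rec_fun k (\<lambda>xs. prod_encode (E xs, F xs))"
  unfolding prod_encode_def prod.case by (intro rec_fun_add rec_fun_triangle)

text \<open>The inverse of the pairing function is obtained by unbounded search, which is directly available in \<^typ>\<open>recf\<close>.\<close>

definition diagonal :: "nat \<Rightarrow> nat" where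
  "diagonal z = (LEAST s. Suc z - triangle (Suc s) = 0)"

definition proj1 :: "nat \<Rightarrow> nat" where
  "proj1 z = z - triangle (diagonal z)"

definition proj2 :: "nat \<Rightarrow> nat" where
  "proj2 z = diagonal z - proj1 z"

lemma triangle_mono: "m \<le> n \<Longrightarrow> triangle m \<le> triangle n"
  by (induction n) (auto simp: le_Suc_eq)

text \<open>The code of \<open>(m, n)\<close> is \<open>triangle (m + n) + m\<close>, so it lies
  below \<open>triangle (Suc (m + n))\<close> but not below earlier triangular numbers. The
  vanishing truncated difference expresses this strict inequality.\<close>

lemma diagonal_prod_encode: "diagonal (prod_encode (m, n)) = m + n"
  unfolding diagonal_def
proof (rule Least_equality)
  show "Suc (prod_encode (m, n)) - triangle (Suc (m + n)) = 0"
    by (simp add: prod_encode_def)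
  fix s assume "Suc (prod_encode (m, n)) - triangle (Suc s) = 0"
  then have "triangle (m + n) < triangle (Suc s)" by (simp add: prod_encode_def)
  then show "m + n \<le> s" using triangle_mono[of "Suc s" "m + n"] by (meson leD not_less_eq_eq)
qed

lemma proj_prod_encode [simp]:
  "proj1 (prod_encode (m, n)) = m" "proj2 (prod_encode (m, n)) = n"
  by (simp_all add: proj1_def proj2_def diagonal_prod_encode) (simp_all add: prod_encode_def)

lemma rec_fun_diagonal: "rec_fun k F \<Longrightarrow> rec_fun k (\<lambda>xs. diagonal (F xs))"
proof (rule rec_fun_app1[where G = diagonal])
  have "\<exists>n. Suc z - triangle (Suc n) = 0" for z
  proof -
    have "z \<le> triangle z" by (induction z) auto
    then show ?thesis by (intro exI[of _ z]) simp
  qed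
  then have "rec_fun 1 (\<lambda>xs. LEAST n. Suc ((n # xs) ! 1) - triangle (Suc ((n # xs) ! 0)) = 0)"
    by (intro rec_fun_Least[where G = "\<lambda>xs. Suc (xs ! 1) - triangle (Suc (xs ! 0))"]
        rec_fun_diff rec_fun_triangle rec_fun_Suc rec_fun_nth) auto
  then show "rec_fun 1 (\<lambda>xs. diagonal (xs ! 0))" by (simp add: diagonal_def)
qed

lemma rec_fun_proj1: "rec_fun k F \<Longrightarrow> rec_fun k (\<lambda>xs. proj1 (F xs))"
  unfolding proj1_def by (intro rec_fun_diff rec_fun_triangle rec_fun_diagonal)

lemma rec_fun_proj2: "rec_fun k F \<Longrightarrow> rec_fun k (\<lambda>xs. proj2 (F xs))"
  unfolding proj2_def by (intro rec_fun_diff rec_fun_diagonal rec_fun_proj1)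

section \<open>A stack machine for coded recursive functions\<close>

abbreviation pr :: "nat \<Rightarrow> nat \<Rightarrow> nat" where
  "pr a b \<equiv> prod_encode (a, b)"

abbreviation cons :: "nat \<Rightarrow> nat \<Rightarrow> nat" where
  "cons a l \<equiv> Suc (pr a l)"

abbreviation head :: "nat \<Rightarrow> nat" where
  "head l \<equiv> proj1 (l - 1)"

abbreviation tail :: "nat \<Rightarrow> nat" where
  "tail l \<equiv> proj2 (l - 1)"

text \<open>The arguments of a composition are stored in reverse since they are evaluated from the last to the first.\<close>

fun code :: "recf \<Rightarrow> nat" where
  "code Zero = pr 0 0"
| "code Succ = pr 1 0"
| "code (Proj i) = pr 2 i"
| "code (Comp f gs) = pr 3 (pr (code f) (list_encode (rev (map code gs))))"
| "code (PrimRec f g) = pr 4 (pr (code f) (code g))"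
| "code (Mini f) = pr 5 (code f)"

text \<open>The first of five kinds of stack frames. \<open>Eval\<close> asks for a value and
  \<open>Args\<close> works through the arguments of a composition; the others wait for a value: of
  an argument, of the previous stage of a recursion, or of a candidate in a search.\<close>

abbreviation Eval :: "nat \<Rightarrow> nat \<Rightarrow> nat" where
  "Eval c xs \<equiv> pr 0 (pr c xs)"

abbreviation Args :: "nat \<Rightarrow> nat \<Rightarrow> nat \<Rightarrow> nat \<Rightarrow> nat" where
  "Args f gs xs acc \<equiv> pr 1 (pr f (pr gs (pr xs acc)))"

abbreviation Arg_ret :: "nat \<Rightarrow> nat \<Rightarrow> nat \<Rightarrow> nat \<Rightarrow> nat" where
  "Arg_ret f gs xs acc \<equiv> pr 2 (pr f (pr gs (pr xs acc)))"

abbreviation Rec_ret :: "nat \<Rightarrow> nat \<Rightarrow> nat \<Rightarrow> nat" where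
  "Rec_ret g n xs \<equiv> pr 3 (pr g (pr n xs))"

abbreviation Mini_ret :: "nat \<Rightarrow> nat \<Rightarrow> nat \<Rightarrow> nat" where
  "Mini_ret f i xs \<equiv> pr 4 (pr f (pr i xs))"

text \<open>A machine state pairs the last returned value with a stack of frames; tags that are not in use share the last case.\<close>

definition eval_step :: "nat \<Rightarrow> nat \<Rightarrow> nat \<Rightarrow> nat \<Rightarrow> nat" where
  "eval_step v c xs K =
     (if proj1 c = 0 then pr 0 K
      else if proj1 c = 1 then pr (Suc (head xs)) K
      else if proj1 c = 2 then
        (if proj2 c = 0 then pr (head xs) K
         else pr v (cons (Eval (pr 2 (proj2 c - 1)) (tail xs)) K))
      else if proj1 c = 3 then pr v (cons (Args (proj1 (proj2 c)) (proj2 (proj2 c)) xs 0) K)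
      else if proj1 c = 4 then
        (if head xs = 0 then pr v (cons (Eval (proj1 (proj2 c)) (tail xs)) K)
         else pr v (cons (Eval c (cons (head xs - 1) (tail xs)))
                     (cons (Rec_ret (proj2 (proj2 c)) (head xs - 1) (tail xs)) K)))
      else pr v (cons (Eval (proj2 c) (cons 0 xs)) (cons (Mini_ret (proj2 c) 0 xs) K)))"

definition args_step :: "nat \<Rightarrow> nat \<Rightarrow> nat \<Rightarrow> nat \<Rightarrow> nat \<Rightarrow> nat \<Rightarrow> nat" where
  "args_step v f gs xs acc K =
     (if gs = 0 then pr v (cons (Eval f acc) K)
      else pr v (cons (Eval (head gs) xs) (cons (Arg_ret f (tail gs) xs acc) K)))"

definition frame_step :: "nat \<Rightarrow> nat \<Rightarrow> nat \<Rightarrow> nat \<Rightarrow> nat" where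
  "frame_step v t a K =
     (if t = 0 then eval_step v (proj1 a) (proj2 a) K
      else if t = 1 then
        args_step v (proj1 a) (proj1 (proj2 a)) (proj1 (proj2 (proj2 a))) (proj2 (proj2 (proj2 a))) K
      else if t = 2 then
        pr v (cons (Args (proj1 a) (proj1 (proj2 a)) (proj1 (proj2 (proj2 a)))
                 (cons v (proj2 (proj2 (proj2 a))))) K)
      else if t = 3 then
        pr v (cons (Eval (proj1 a) (cons (proj1 (proj2 a)) (cons v (proj2 (proj2 a))))) K)
      else if v = 0 then pr (proj1 (proj2 a)) K
      else pr v (cons (Eval (proj1 a) (cons (Suc (proj1 (proj2 a))) (proj2 (proj2 a))))
             (cons (Mini_ret (proj1 a) (Suc (proj1 (proj2 a))) (proj2 (proj2 a))) K)))"

definition step :: "nat \<Rightarrow> nat" where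
  "step s =
     (if proj2 s = 0 then s
      else frame_step (proj1 s) (proj1 (head (proj2 s))) (proj2 (head (proj2 s))) (tail (proj2 s)))"

lemma step_cons [simp]: "step (pr v (cons (pr t a) K)) = frame_step v t a K"
  by (simp add: step_def)

lemmas rec_fun_intros =
  rec_fun_const rec_fun_nth rec_fun_Suc rec_fun_prod_encode rec_fun_proj1 rec_fun_proj2 rec_fun_pred
  rec_fun_if_eq

lemma rec_fun_step: "rec_fun k F \<Longrightarrow> rec_fun k (\<lambda>xs. step (F xs))"
  unfolding step_def frame_step_def eval_step_def args_step_def
  by (intro rec_fun_intros)

definition reaches :: "nat \<Rightarrow> nat \<Rightarrow> bool" where
  "reaches s t \<longleftrightarrow> (\<exists>n. (step ^^ n) s = t)"

lemma reaches_trans: "reaches s t \<Longrightarrow> reaches t u \<Longrightarrow> reaches s u"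
  unfolding reaches_def by (metis funpow_add comp_apply)

lemma reaches_step: "reaches (step s) t \<Longrightarrow> reaches s t"
  unfolding reaches_def by (metis funpow_swap1 funpow.simps(2) comp_apply)

lemma reaches_refl: "reaches s s"
  unfolding reaches_def by (rule exI[of _ 0]) simp

text \<open>The old value \<open>v\<close> and the rest \<open>K\<close> of the stack are arbitrary,
  so that evaluations can be nested.\<close>

definition evaluates :: "nat \<Rightarrow> nat list \<Rightarrow> nat \<Rightarrow> bool" where
  "evaluates c xs y \<longleftrightarrow> (\<forall>v K. reaches (pr v (cons (Eval c (list_encode xs)) K)) (pr y K))"

text \<open>The value of the last function is put in front of \<open>acc\<close> first, so the
  values end up in the right order; hence the induction from the right.\<close>

lemma reaches_Args:
  assumes "list_all2 (\<lambda>g y. evaluates (code g) xs y) gs ys"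
  shows "\<exists>v'. reaches (pr v (cons (Args f (list_encode (rev (map code gs))) (list_encode xs) (list_encode acc)) K))
     (pr v' (cons (Eval f (list_encode (ys @ acc))) K))"
  using assms
proof (induction gs arbitrary: ys acc v rule: rev_induct)
  case Nil
  then show ?case
    by (intro exI[of _ v] reaches_step[of "pr v _"]) (simp add: frame_step_def args_step_def reaches_refl)
next
  case (snoc g gs)
  then obtain zs y where ys: "ys = zs @ [y]" "list_all2 (\<lambda>g y. evaluates (code g) xs y) gs zs"
    "evaluates (code g) xs y"
    by (auto simp: list_all2_append1 list_all2_Cons1)
  let ?K = "\<lambda>t acc. cons (pr t (pr f (pr (list_encode (rev (map code gs))) (pr (list_encode xs) (list_encode acc))))) K"
  have "reaches (pr v (cons (Args f (list_encode (rev (map code (gs @ [g])))) (list_encode xs) (list_encode acc)) K))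
     (pr y (?K 2 acc))"
    by (rule reaches_step) (use ys(3) in \<open>simp add: frame_step_def args_step_def evaluates_def\<close>)
  moreover have "reaches (pr y (?K 2 acc)) (pr y (?K 1 (y # acc)))"
    by (rule reaches_step) (simp add: frame_step_def reaches_refl)
  ultimately have *: "reaches (pr v (cons (Args f (list_encode (rev (map code (gs @ [g])))) (list_encode xs) (list_encode acc)) K))
     (pr y (?K 1 (y # acc)))"
    by (rule reaches_trans)
  obtain v' where "reaches (pr y (?K 1 (y # acc))) (pr v' (cons (Eval f (list_encode (zs @ y # acc))) K))"
    using snoc.IH[OF ys(2)] by blast
  from reaches_trans[OF * this] show ?case by (auto simp: ys(1))
qed

lemma evaluates_code: "reval f xs y \<Longrightarrow> evaluates (code f) xs y"
proof (induction rule: reval.induct)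
  case (zero xs)
  show ?case unfolding evaluates_def
    by (intro allI reaches_step[of "pr _ _"]) (simp add: frame_step_def eval_step_def reaches_refl)
next
  case (succ x xs)
  show ?case unfolding evaluates_def
    by (intro allI reaches_step[of "pr _ _"]) (simp add: frame_step_def eval_step_def reaches_refl)
next
  case (proj i xs)
  then show ?case
  proof (induction i arbitrary: xs)
    case 0
    then show ?case unfolding evaluates_def
      by (intro allI reaches_step[of "pr _ _"])
        (cases xs; simp add: frame_step_def eval_step_def reaches_refl)
  next
    case (Suc i)
    then obtain x xs' where xs: "xs = x # xs'" "i < length xs'" by (cases xs) auto
    show ?case unfolding evaluates_def
      by (intro allI reaches_step[of "pr _ _"])
        (use Suc.IH[OF xs(2)] in \<open>simp add: xs(1) frame_step_def eval_step_def evaluates_def\<close>)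
  qed
next
  case (comp xs gs ys f z)
  have "list_all2 (\<lambda>g y. evaluates (code g) xs y) gs ys"
    using comp.IH(1) by (rule list_all2_mono) simp
  note args = reaches_Args[OF this, of _ "code f" "[]"]
  show ?case unfolding evaluates_def
  proof (intro allI)
    fix v K
    obtain v' where "reaches (pr v (cons (Args (code f) (list_encode (rev (map code gs))) (list_encode xs) (list_encode [])) K))
      (pr v' (cons (Eval (code f) (list_encode (ys @ []))) K))"
      using args by blast
    then have "reaches (step (pr v (cons (Eval (code (Comp f gs)) (list_encode xs)) K)))
        (pr v' (cons (Eval (code f) (list_encode ys)) K))"
      by (simp add: frame_step_def eval_step_def)
    moreover have "reaches (pr v' (cons (Eval (code f) (list_encode ys)) K)) (pr z K)"
      using comp.IH(2) by (simp add: evaluates_def)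
    ultimately show "reaches (pr v (cons (Eval (code (Comp f gs)) (list_encode xs)) K)) (pr z K)"
      by (metis reaches_step reaches_trans)
  qed
next
  case (pr0 f xs z g)
  show ?case unfolding evaluates_def
    by (intro allI reaches_step[of "pr _ _"])
      (use pr0.IH in \<open>simp add: frame_step_def eval_step_def evaluates_def\<close>)
next
  case (prS f g n xs y z)
  show ?case unfolding evaluates_def
  proof (intro allI)
    fix v K
    let ?K = "cons (Rec_ret (code g) n (list_encode xs)) K"
    have "reaches (pr v (cons (Eval (code (PrimRec f g)) (list_encode (Suc n # xs))) K)) (pr y ?K)"
      by (rule reaches_step)
        (use prS.IH(1) in \<open>simp add: frame_step_def eval_step_def evaluates_def\<close>)
    moreover have "reaches (pr y ?K) (pr z K)"
      by (rule reaches_step) (use prS.IH(2) in \<open>simp add: frame_step_def evaluates_def\<close>)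
    ultimately show "reaches (pr v (cons (Eval (code (PrimRec f g)) (list_encode (Suc n # xs))) K)) (pr z K)"
      by (rule reaches_trans)
  qed
next
  case (mini f n xs)
  then obtain k where k: "\<And>m. m < n \<Longrightarrow> evaluates (code f) (m # xs) (Suc (k m))" by metis
  show ?case unfolding evaluates_def
  proof (intro allI)
    fix v K
    \<comment> \<open>The state in which candidate \<open>m\<close> is about to be tested. The
      induction below runs on the distance \<open>j\<close> from the solution
      \<open>n\<close>.\<close>
    define T where "T m v = pr v (cons (Eval (code f) (list_encode (m # xs)))
      (cons (Mini_ret (code f) m (list_encode xs)) K))" for m v
    have "reaches (T (n - j) v) (pr n K)" if "j \<le> n" for j v
      using that
    proof (induction j arbitrary: v)
      case 0
      have "reaches (T n v) (pr 0 (cons (Mini_ret (code f) n (list_encode xs)) K))"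
        using mini.IH(1) unfolding T_def evaluates_def by blast
      moreover have "reaches (pr 0 (cons (Mini_ret (code f) n (list_encode xs)) K)) (pr n K)"
        by (rule reaches_step) (simp add: frame_step_def reaches_refl)
      ultimately show ?case using reaches_trans by simp
    next
      case (Suc j)
      define m where "m = n - Suc j"
      have m: "m < n" "n - j = Suc m" using Suc.prems by (auto simp: m_def)
      have "reaches (T m v) (pr (Suc (k m)) (cons (Mini_ret (code f) m (list_encode xs)) K))"
        using k[OF m(1)] unfolding T_def evaluates_def by blast
      moreover have "reaches (pr (Suc (k m)) (cons (Mini_ret (code f) m (list_encode xs)) K)) (pr n K)"
        using Suc.IH[OF Suc_leD[OF Suc.prems], of "Suc (k m)"]
        by (intro reaches_step[of "pr _ _"]) (simp add: frame_step_def m(2) T_def)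
      ultimately show ?case unfolding m_def[symmetric] by (rule reaches_trans)
    qed
    from this[of n v] show "reaches (pr v (cons (Eval (code (Mini f)) (list_encode xs)) K)) (pr n K)"
      by (intro reaches_step[of "pr _ _"]) (simp add: frame_step_def eval_step_def T_def)
  qed
qed

lemma rec_fun_funpow_step: "rec_fun k N \<Longrightarrow> rec_fun k F \<Longrightarrow> rec_fun k (\<lambda>xs. (step ^^ N xs) (F xs))"
proof -
  assume "rec_fun k N" "rec_fun k F"
  then have "rec_fun k (\<lambda>xs. rec_nat (F xs) (\<lambda>n y. step ((n # y # xs) ! 1)) (N xs))"
    by (intro rec_fun_rec_nat[where G = "\<lambda>xs. step (xs ! 1)"] rec_fun_step rec_fun_nth) auto
  moreover have "rec_nat a (\<lambda>n y. step ((n # y # xs) ! 1)) n = (step ^^ n) a" for a n and xs :: "nat list"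
    by (induction n) auto
  ultimately show ?thesis by simp
qed

text \<open>The diagonal of a universal function: \<open>d\<close> simulates \<open>f\<close> on the
  code of \<open>f\<close> itself.\<close>

lemma universal: "\<exists>d. \<forall>f y. reval f [code f] y \<longrightarrow> reval d [code f] y"
proof -
  define init where "init c = pr 0 (cons (Eval c (cons c 0)) 0)" for c
  define run where "run t c = (step ^^ t) (init c)" for t c
  have "rec_fun 2 (\<lambda>xs. run (xs ! 0) (xs ! 1))"
    unfolding run_def init_def by (intro rec_fun_intros rec_fun_funpow_step) auto
  then have "rec_fun 2 (\<lambda>xs. proj1 (run (xs ! 0) (xs ! 1)))" "rec_fun 2 (\<lambda>xs. proj2 (run (xs ! 0) (xs ! 1)))"
    by (simp_all add: rec_fun_proj1 rec_fun_proj2)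
  then obtain p q where "\<forall>xs. length xs = 2 \<longrightarrow> reval p xs (proj1 (run (xs ! 0) (xs ! 1)))"
    "\<forall>xs. length xs = 2 \<longrightarrow> reval q xs (proj2 (run (xs ! 0) (xs ! 1)))"
    unfolding rec_fun_def by blast
  then have p: "reval p [t, c] (proj1 (run t c))" and q: "reval q [t, c] (proj2 (run t c))" for t c
    by (metis length_Cons list.size(3) nth_Cons_0 nth_Cons_Suc numeral_2_eq_2 One_nat_def)+
  \<comment> \<open>\<open>Mini q\<close> searches for the first time at which the stack is empty,
    and \<open>p\<close> reads off the value returned by then.\<close>
  have "reval (Comp p [Mini q, Proj 0]) [code f] y" if "reval f [code f] y" for f y
  proof -
    define c where "c = code f"
    have "reaches (init c) (pr y 0)"
      using evaluates_code[OF that] unfolding evaluates_def init_def c_def by simp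
    then obtain n where n: "run n c = pr y 0" unfolding reaches_def run_def by blast
    define T where "T = (LEAST t. proj2 (run t c) = 0)"
    have T: "proj2 (run T c) = 0" unfolding T_def by (rule LeastI[of _ n]) (simp add: n)
    have "T \<le> n" unfolding T_def by (rule Least_le) (simp add: n)
    \<comment> \<open>With an empty stack \<open>step\<close> is the identity, so the value at time
      \<open>T\<close> is still there at time \<open>n\<close>.\<close>
    have "run (T + k) c = run T c" for k
      by (induction k) (auto simp: run_def step_def T[unfolded run_def])
    from this[of "n - T"] have y: "proj1 (run T c) = y" using n \<open>T \<le> n\<close>
      by (metis le_add_diff_inverse proj_prod_encode(1))
    have "reval (Mini q) [c] T"
    proof (rule reval.mini)
      show "reval q [T, c] 0" using q[of T c] T by simp
      show "\<forall>m<T. \<exists>y. reval q [m, c] (Suc y)"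
      proof (intro allI impI)
        fix m assume "m < T"
        then have "proj2 (run m c) \<noteq> 0" unfolding T_def by (rule not_less_Least)
        then show "\<exists>y. reval q [m, c] (Suc y)" using q[of m c] by (metis not0_implies_Suc)
      qed
    qed
    moreover have "reval (Proj 0) [c] c" using reval.proj[of 0 "[c]"] by simp
    ultimately show ?thesis using p[of T c] y unfolding c_def[symmetric]
      by (intro reval.comp[where ys = "[T, c]"]) auto
  qed
  then show ?thesis by blast
qed

section \<open>The diagonal argument\<close>

lemma rec_fun_input_nat: "rec_fun 1 (\<lambda>xs. list_encode (input_nat P (xs ! 0)))"
proof -
  define a b where "a = (to_nat (Ctr 0) :: nat)" and "b = list_encode [to_nat End]"
  have "rec_fun 1 (\<lambda>xs. cons (to_nat (St P)) (rec_nat b (\<lambda>n y. cons a ((n # y # xs) ! 1)) (xs ! 0)))"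
    by (intro rec_fun_intros rec_fun_rec_nat[where G = "\<lambda>xs. cons a (xs ! 1)"]) auto
  moreover have "list_encode (replicate n a @ [to_nat End]) = rec_nat b (\<lambda>n y. cons a ((n # y # xs) ! 1)) n"
    for n and xs :: "nat list"
    by (induction n) (auto simp: b_def)
  ultimately show ?thesis by (simp add: input_nat_def input_def a_def map_replicate)
qed

theorem theorem5p1:
  shows "\<exists>(S :: nat monoid) (A :: nat set) L Leq La sigma.
           monoid S \<and> finitely_presented S \<and>
           automatic_structure S A L Leq La sigma \<and>
           \<not> decidable_on L (\<lambda>w. has_right_inverse S (sigma w))"
proof -
  obtain d where d: "\<And>f y. reval f [code f] y \<Longrightarrow> reval d [code f] y" using universal by blast
  \<comment> \<open>Whenever \<open>d\<close> returns a value on the input, \<open>P\<close> halts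
    iff this value is \<open>0\<close>.\<close>
  define P where "P = compile d [0] 1 2 @ [Loop 1 [Inc 1]]"
  obtain S :: "nat monoid" and A :: "nat set" and L Leq La sigma where
    S: "monoid S" "finitely_presented S" "automatic_structure S A L Leq La sigma"
    and L: "\<And>n. input_nat P n \<in> L"
    and inv: "\<And>n. has_right_inverse S (sigma (input_nat P n)) \<longleftrightarrow> halts (P, (\<lambda>_. 0)(0 := n))"
    using program_monoid[of P] by blast
  have "\<not> decidable_on L (\<lambda>w. has_right_inverse S (sigma w))"
  proof
    assume "decidable_on L (\<lambda>w. has_right_inverse S (sigma w))"
    then obtain f where f: "\<And>w. w \<in> L \<Longrightarrow>
        reval f [list_encode w] (if has_right_inverse S (sigma w) then 1 else 0)"
      unfolding decidable_on_def by blast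
    obtain e where "\<forall>xs. length xs = 1 \<longrightarrow> reval e xs (list_encode (input_nat P (xs ! 0)))"
      using rec_fun_input_nat unfolding rec_fun_def by blast
    then have "reval e [n] (list_encode (input_nat P ([n] ! 0)))" for n
      by (metis One_nat_def length_Cons list.size(3))
    then have e: "reval e [n] (list_encode (input_nat P n))" for n by simp
    \<comment> \<open>The supposed decider, preceded by the map from \<open>n\<close> to its input
      word, is applied to its own code.\<close>
    define c where "c = code (Comp f [e])"
    define y :: nat where "y = (if has_right_inverse S (sigma (input_nat P c)) then 1 else 0)"
    have "reval (Comp f [e]) [c] y"
      unfolding y_def using e f[OF L] by (intro reval.comp[where ys = "[list_encode (input_nat P c)]"]) auto
    then have "reval d [c] y" unfolding c_def by (rule d)
    \<comment> \<open>By choice of \<open>y\<close>, it is \<open>1\<close> iff the word for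
      \<open>c\<close> has a right inverse, that is iff \<open>P\<close> halts on \<open>c\<close>,
      that is iff \<open>y = 0\<close>.\<close>
    from halts_compile[OF this] inv[of c] show False by (auto simp: P_def y_def split: if_splits)
  qed
  with S show ?thesis by blast
qed

end
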